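(* Let $d\ge 1$, $\gamma\in\mathbb{R}\setminus\{0\}$ and $b<0$, and let $Z$ be the interacting branching diffusion in $\mathbb{R}^d$ with drift parameter $b$ and interaction parameter $\gamma$, with center of mass $\overline{Z_t}$. Then $$\lim_{t\to\infty}e^{bt}\,\overline{Z_t}=\mathcal{N}\quad\text{almost surely},$$ where $\mathcal{N}$ is a ($d$-dimensional) normal random variable with mean zero and covariance matrix $$\frac{1-e^{2b}}{|b|\,(2-e^{2b})}\cdot I_d,$$ $I_d$ being the $d\times d$ identity matrix.
   Context: Model. Fix $d\ge1$, $b\in\mathbb{R}$ and $\gamma\neq 0$. The process $Z$ starts at time $0$ with one particle at the origin of $\mathbb{R}^d$. For each $m=0,1,2,\dots$, during the time interval $[m,m+1)$ there are exactly $2^m$ particles, with positions $Z_t^i$, $1\le i\le 2^m$; at each integer time $m\ge 1$ every particle is replaced by exactly two offspring, located at the parent's position (labels are arbitrary but independent of the spatial motion). On $[m,m+1)$ the positions satisfy $$\mathrm{d}Z_t^i = \mathrm{d}W_t^{i,m} - bZ_t^i\,\mathrm{d}t + \frac{1}{2^m}\sum_{j=1}^{2^m}\gamma\,(Z_t^j-Z_t^i)\,\mathrm{d}t,\qquad 1\le i\le 2^m,$$ where $\{W^{i,m}\}_{1\le i\le 2^m}$ are independent standard $d$-dimensional Brownian motions on $[m,m+1)$, also independent of the past up to time $m$. Center of mass: for $t\in[m,m+1)$, $\overline{Z_t}:=2^{-m}\sum_{i=1}^{2^m}Z_t^i$. *)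

theory Defs
  imports "HOL-Probability.Probability"
begin

(* Lebesgue density of the normal law with mean \<mu> and covariance matrix \<Sigma>.  Meaningful only for
   positive definite \<Sigma>; every use below has \<Sigma> = c I with c > 0. *)
definition multivariate_normal_density ::
    "real ^ 'n \<Rightarrow> real ^ 'n ^ 'n \<Rightarrow> real ^ 'n \<Rightarrow> real" where
  "multivariate_normal_density \<mu> \<Sigma> x =
     exp (- ((x - \<mu>) \<bullet> (matrix_inv \<Sigma> *v (x - \<mu>))) / 2)
       / sqrt ((2 * pi) ^ CARD('n) * det \<Sigma>)"

definition multivariate_normal ::
    "'w measure \<Rightarrow> ('w \<Rightarrow> real ^ 'n) \<Rightarrow> real ^ 'n \<Rightarrow> real ^ 'n ^ 'n \<Rightarrow> bool" where
  "multivariate_normal M X \<mu> \<Sigma> \<longleftrightarrow>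
     distributed M lborel X (\<lambda>x. ennreal (multivariate_normal_density \<mu> \<Sigma> x))"

definition standard_brownian_motion_on ::
    "'w measure \<Rightarrow> real \<Rightarrow> real \<Rightarrow> (real \<Rightarrow> 'w \<Rightarrow> real ^ 'n) \<Rightarrow> bool" where
  "standard_brownian_motion_on M a c W \<longleftrightarrow>
     (\<forall>t\<in>{a..<c}. W t \<in> borel_measurable M) \<and>
     (AE \<omega> in M. W a \<omega> = 0) \<and>
     (\<forall>(n::nat) \<tau>. (\<forall>k\<le>n. \<tau> k \<in> {a..<c}) \<and> (\<forall>k<n. \<tau> k \<le> \<tau> (Suc k)) \<longrightarrow>
        prob_space.indep_vars M (\<lambda>_. borel) (\<lambda>k \<omega>. W (\<tau> (Suc k)) \<omega> - W (\<tau> k) \<omega>) {..<n}) \<and>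
     (\<forall>s\<in>{a..<c}. \<forall>t\<in>{a..<c}. s < t \<longrightarrow>
        multivariate_normal M (\<lambda>\<omega>. W t \<omega> - W s \<omega>) 0 ((t - s) *\<^sub>R mat 1)) \<and>
     (AE \<omega> in M. continuous_on {a..<c} (\<lambda>t. W t \<omega>))"

definition cylinder_events ::
    "'w measure \<Rightarrow> ('j \<Rightarrow> 'w \<Rightarrow> 'b::topological_space) \<Rightarrow> 'j set \<Rightarrow> 'w set set" where
  "cylinder_events M X J = {X j -` A \<inter> space M | j A. j \<in> J \<and> A \<in> sets borel}"

(* The sigma-algebra generated by the family (X j), j in J. *)
definition generated_events ::
    "'w measure \<Rightarrow> ('j \<Rightarrow> 'w \<Rightarrow> 'b::topological_space) \<Rightarrow> 'j set \<Rightarrow> 'w set set" where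
  "generated_events M X J = sigma_sets (space M) (cylinder_events M X J)"

(* Number of particles alive at time t, i.e. 2 ^ m for t in [m, m + 1). *)
definition num_particles :: "real \<Rightarrow> nat" where
  "num_particles t = 2 ^ nat \<lfloor>t\<rfloor>"

definition center_of_mass :: "(real \<Rightarrow> nat \<Rightarrow> 'w \<Rightarrow> real ^ 'n) \<Rightarrow> real \<Rightarrow> 'w \<Rightarrow> real ^ 'n" where
  "center_of_mass Z t \<omega> = (1 / real (num_particles t)) *\<^sub>R (\<Sum>i = 1..num_particles t. Z t i \<omega>)"

(* The past up to (and including) time m: particle positions, the Brownian motions of the earlier
   unit intervals, and the genealogical labels p k assigned at the branching times k + 1 \<le> m. *)
definition past_events ::
    "'w measure \<Rightarrow> (real \<Rightarrow> nat \<Rightarrow> 'w \<Rightarrow> real ^ 'n) \<Rightarrow> (nat \<Rightarrow> nat \<Rightarrow> real \<Rightarrow> 'w \<Rightarrow> real ^ 'n) \<Rightarrow>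
     (nat \<Rightarrow> nat \<Rightarrow> 'w \<Rightarrow> nat) \<Rightarrow> nat \<Rightarrow> 'w set set" where
  "past_events M Z W p m = sigma_sets (space M)
     (cylinder_events M (\<lambda>(t, i). Z t i) (SIGMA t:{0..real m}. {1..num_particles t}) \<union>
      cylinder_events M (\<lambda>(k, i, t). W k i t)
        (SIGMA k:{..<m}. {1..2 ^ k} \<times> {real k..<real k + 1}) \<union>
      cylinder_events M (\<lambda>(k, i). p k i) (SIGMA k:{..<m}. {1..2 ^ Suc k}))"

(* Z t i is the position at time t of particle i (i = 1, ..., 2 ^ m for t in [m, m + 1)), W m i the
   Brownian motion driving it on [m, m + 1), and p m i the label, among 1, ..., 2 ^ m, of the parent
   of the particle that carries label i from time m + 1 on.  The (possibly random) parent maps p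
   encode the arbitrary labelling: all that is required is that every parent has exactly two
   children and that p is independent of the driving Brownian motions.  The particle positions
   themselves reveal who is whose sibling, so they cannot be used in the latter condition.
   The stochastic differential equation has additive noise and is stated pathwise in integral form. *)
locale interacting_branching_diffusion = prob_space M
  for M :: "'w measure" +
  fixes b \<gamma> :: real
    and Z :: "real \<Rightarrow> nat \<Rightarrow> 'w \<Rightarrow> real ^ 'n"
    and W :: "nat \<Rightarrow> nat \<Rightarrow> real \<Rightarrow> 'w \<Rightarrow> real ^ 'n"
    and p :: "nat \<Rightarrow> nat \<Rightarrow> 'w \<Rightarrow> nat"
  assumes Z_measurable:
      "\<And>t i. 0 \<le> t \<Longrightarrow> i \<in> {1..num_particles t} \<Longrightarrow> Z t i \<in> borel_measurable M"
    and p_measurable: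
      "\<And>m i. i \<in> {1..2 ^ Suc m} \<Longrightarrow> p m i \<in> measurable M (count_space UNIV)"
    and brownian:
      "\<And>m i. i \<in> {1..2 ^ m} \<Longrightarrow> standard_brownian_motion_on M (real m) (real m + 1) (W m i)"
    and brownian_indep:
      "\<And>m. indep_sets (\<lambda>i. generated_events M (W m i) {real m..<real m + 1}) {1..2 ^ m}"
    and brownian_indep_past:
      "\<And>m. indep_set
         (generated_events M (\<lambda>(i, t). W m i t) ({1..2 ^ m} \<times> {real m..<real m + 1}))
         (past_events M Z W p m)"
    and labels_indep_motion:
      "indep_set
         (generated_events M (\<lambda>(m, i). p m i) (SIGMA m:UNIV. {1..2 ^ Suc m}))
         (generated_events M (\<lambda>(m, i, t). W m i t)
           (SIGMA m:UNIV. {1..2 ^ m} \<times> {real m..<real m + 1}))"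
    and initial: "AE \<omega> in M. Z 0 1 \<omega> = 0"
    and two_offspring:
      "\<And>m. AE \<omega> in M. (\<forall>i\<in>{1..2 ^ Suc m}. p m i \<omega> \<in> {1..2 ^ m}) \<and>
         (\<forall>j\<in>{1..2 ^ m}. card {i \<in> {1..2 ^ Suc m}. p m i \<omega> = j} = 2)"
    and offspring_position:
      "\<And>m i. i \<in> {1..2 ^ Suc m} \<Longrightarrow>
         AE \<omega> in M. ((\<lambda>t. Z t (p m i \<omega>) \<omega>) \<longlongrightarrow> Z (real (Suc m)) i \<omega>) (at_left (real (Suc m)))"
    and continuous_motion:
      "\<And>m i. i \<in> {1..2 ^ m} \<Longrightarrow>
         AE \<omega> in M. continuous_on {real m..<real m + 1} (\<lambda>t. Z t i \<omega>)"
    and motion: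
      "\<And>m i. i \<in> {1..2 ^ m} \<Longrightarrow>
         AE \<omega> in M. \<forall>t\<in>{real m..<real m + 1}.
           Z t i \<omega> = Z (real m) i \<omega> + (W m i t \<omega> - W m i (real m) \<omega>)
             + integral {real m..t} (\<lambda>s. - b *\<^sub>R Z s i \<omega>
                 + (1 / 2 ^ m) *\<^sub>R (\<Sum>j = 1..2 ^ m. \<gamma> *\<^sub>R (Z s j \<omega> - Z s i \<omega>)))"

end

theory Submission
  imports Defs
begin

text \<open>
  When the equations of the \<open>2 ^ m\<close> particles alive during \<open>[m, m + 1)\<close> are averaged, the interaction
  terms cancel, and at a branching time every parent is replaced by two children at its own position.
  The center of mass \<open>A\<close> is therefore continuous and solves \<open>dA = dB - b A dt\<close>, where the noise \<open>B\<close> on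
  \<open>[m, m + 1)\<close> is the average of \<open>2 ^ m\<close> independent Brownian motions
  (\<open>AE_center_of_mass_motion\<close>, \<open>AE_center_of_mass_left_limit\<close>). Hence \<open>Y t = exp (b t) A t\<close> is the
  Wiener integral of \<open>exp (b r)\<close> against \<open>B\<close>. Generation \<open>m\<close> contributes an independent centered
  Gaussian variable with covariance \<open>2 ^ (- m)\<close> times the integral of \<open>exp (2 b r)\<close> over \<open>[m, m + 1]\<close>,
  times the identity, and these variances form a geometric series with ratio \<open>exp (2 b) / 2\<close>, whose sum is
  the variance in the theorem.

  The law is found without a theory of stochastic integration. The noise being additive, \<open>Y t\<close> is a
  pathwise limit of Riemann sums (\<open>weighted_riemann_sums_converge\<close>). For a fixed mesh, \<open>Y m\<close> plus the
  Riemann sum is a sum of independent isotropic Gaussian vectors, and almost sure limits of Gaussian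
  vectors with convergent variances are Gaussian (\<open>gaussian_limit\<close>). This gives the law of \<open>Y m\<close> by
  induction on \<open>m\<close> (\<open>weighted_center_gaussian\<close>), and one more limit gives the law of the limit of \<open>Y\<close>.

  For convergence along all real times the oscillation of \<open>Y\<close> on \<open>[m, m + 1)\<close> must be summable in \<open>m\<close>.
  As \<open>b\<close> is negative, it suffices that the supremum of the noise on \<open>[m, m + 1)\<close> grows at a smaller
  exponential rate than \<open>exp (- b m)\<close>. Fourth moments of the increments over dyadic intervals and a chaining argument show that it
  is at most a random multiple of \<open>exp (- b m / 2)\<close>
  (\<open>AE_dyadic_increment_bound\<close>, \<open>chaining_bound\<close>).
\<close>

section \<open>Isotropic Gaussian laws\<close>

text \<open>Writing the isotropic density as a product over the coordinates lets Fubini reduce its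
  convolutions and moments to the one-dimensional ones.\<close>

definition iso_normal_density :: "real \<Rightarrow> 'a::euclidean_space \<Rightarrow> real" where
  "iso_normal_density v x = (\<Prod>b\<in>Basis. normal_density 0 (sqrt v) (x \<bullet> b))"

lemma iso_normal_density_nonneg [simp]: "0 \<le> iso_normal_density v x"
  by (simp add: iso_normal_density_def prod_nonneg)

lemma borel_measurable_iso_normal_density [measurable]:
  "iso_normal_density v \<in> borel_measurable borel"
  unfolding iso_normal_density_def[abs_def] by measurable

lemma nn_integral_iso_normal_density:
  assumes "0 < v"
  shows "(\<integral>\<^sup>+x. ennreal (iso_normal_density v (x::'a::euclidean_space)) \<partial>lborel) = 1"
proof -
  have "(\<integral>\<^sup>+x. ennreal (normal_density 0 (sqrt v) x) \<partial>lborel) = 1"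
    using prob_space.emeasure_space_1[OF prob_space_normal_density[of "sqrt v" 0]] assms
    by (simp add: emeasure_density)
  then have "(\<integral>\<^sup>+x. (\<Prod>b\<in>Basis. ennreal (normal_density 0 (sqrt v) ((x::'a) \<bullet> b))) \<partial>lborel) = 1"
    by (subst nn_integral_lborel_prod) simp_all
  then show ?thesis
    by (simp add: iso_normal_density_def prod_ennreal)
qed

text \<open>The law is the image of the standard one under scaling, so that it makes sense for variance
  \<open>0\<close> as well, where it is the point mass at the origin. The degenerate case is needed because
  the center of mass starts at the origin.\<close>

definition gaussian_law :: "real \<Rightarrow> 'a::euclidean_space measure" where
  "gaussian_law v = distr (density lborel (iso_normal_density 1)) borel (\<lambda>x. sqrt v *\<^sub>R x)"

lemma sets_gaussian_law [simp, measurable_cong]: "sets (gaussian_law v) = sets borel"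
  by (simp add: gaussian_law_def)

lemma space_gaussian_law [simp]: "space (gaussian_law v) = UNIV"
  by (simp add: gaussian_law_def)

lemma prob_space_gaussian_law [simp]: "prob_space (gaussian_law v)"
proof -
  have "prob_space (density lborel (\<lambda>x::'a. ennreal (iso_normal_density 1 x)))"
    by (intro prob_spaceI) (simp add: emeasure_density nn_integral_iso_normal_density)
  then show ?thesis
    unfolding gaussian_law_def by (intro prob_space.prob_space_distr) simp_all
qed

lemma iso_normal_density_rescale:
  fixes x :: "'a::euclidean_space"
  assumes "0 < v"
  shows "sqrt v ^ DIM('a) * iso_normal_density v (sqrt v *\<^sub>R x) = iso_normal_density 1 x"
proof -
  have "sqrt v * normal_density 0 (sqrt v) (sqrt v * y) = normal_density 0 1 y" for y
    using assms by (simp add: normal_density_def real_sqrt_mult power_mult_distrib)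
  then have "(\<Prod>b\<in>Basis. sqrt v * normal_density 0 (sqrt v) (sqrt v * (x \<bullet> b))) = iso_normal_density 1 x"
    by (simp add: iso_normal_density_def)
  then show ?thesis
    by (simp add: iso_normal_density_def prod.distrib)
qed

text \<open>Substitution by the dilation with factor \<open>sqrt v\<close>, whose Jacobian is \<open>sqrt v ^ DIM('a)\<close>.\<close>

lemma gaussian_law_eq_density:
  assumes "0 < v"
  shows "gaussian_law v = density lborel (iso_normal_density v :: 'a::euclidean_space \<Rightarrow> real)"
proof (rule measure_eqI)
  show "sets (gaussian_law v) = sets (density lborel (iso_normal_density v :: 'a \<Rightarrow> real))"
    by simp
next
  fix A :: "'a set" assume "A \<in> sets (gaussian_law v)"
  then have [measurable]: "A \<in> sets borel" by simp
  have s: "sqrt v > 0" using assms by simp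
  have "emeasure (gaussian_law v) A
      = (\<integral>\<^sup>+x. ennreal (iso_normal_density 1 x) * indicator A (sqrt v *\<^sub>R x) \<partial>lborel)"
    by (simp add: gaussian_law_def nn_integral_density nn_integral_distr flip: nn_integral_indicator)
  also have "\<dots> = (\<integral>\<^sup>+x. ennreal (sqrt v ^ DIM('a))
      * (ennreal (iso_normal_density v (sqrt v *\<^sub>R x)) * indicator A (sqrt v *\<^sub>R x)) \<partial>lborel)"
    using s by (intro nn_integral_cong)
      (simp add: iso_normal_density_rescale[OF assms, symmetric] ennreal_mult mult.assoc)
  also have "\<dots> = (\<integral>\<^sup>+x. ennreal (iso_normal_density v x) * indicator A x \<partial>
      density (distr lborel borel (\<lambda>x. 0 + sqrt v *\<^sub>R x)) (\<lambda>_. ennreal (\<bar>sqrt v\<bar> ^ DIM('a))))"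
    using s by (simp add: nn_integral_density nn_integral_distr)
  also have "\<dots> = (\<integral>\<^sup>+x. ennreal (iso_normal_density v x) * indicator A x \<partial>lborel)"
    using s by (subst (2) lborel_affine[of "sqrt v" 0]) simp_all
  also have "\<dots> = emeasure (density lborel (iso_normal_density v :: 'a \<Rightarrow> real)) A"
    by (simp add: emeasure_density)
  finally show "emeasure (gaussian_law v) A
    = emeasure (density lborel (iso_normal_density v :: 'a \<Rightarrow> real)) A" .
qed

lemma gaussian_law_0: "gaussian_law 0 = return borel (0::'a::euclidean_space)"
proof -
  interpret prob_space "density lborel (\<lambda>x::'a. ennreal (iso_normal_density 1 x))"
    by (intro prob_spaceI) (simp add: emeasure_density nn_integral_iso_normal_density)
  show ?thesis
    using distr_const[of "0::'a" borel] by (simp add: gaussian_law_def)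
qed

text \<open>Both densities are products over the coordinates, so the convolution factorises into
  one-dimensional convolutions of normal densities.\<close>

lemma iso_normal_density_convolution:
  fixes x :: "'a::euclidean_space"
  assumes "0 < v" "0 < w"
  shows "(\<integral>\<^sup>+y. ennreal (iso_normal_density v (x - y)) * ennreal (iso_normal_density w y) \<partial>lborel)
    = ennreal (iso_normal_density (v + w) x)"
proof -
  let ?f = "\<lambda>b y. ennreal (normal_density 0 (sqrt v) (x \<bullet> b - y) * normal_density 0 (sqrt w) y)"
  have "(\<integral>\<^sup>+y. ennreal (iso_normal_density v (x - y)) * ennreal (iso_normal_density w y) \<partial>lborel)
      = (\<integral>\<^sup>+y. (\<Prod>b\<in>Basis. ?f b (y \<bullet> b)) \<partial>lborel)"
    by (simp add: iso_normal_density_def prod_ennreal prod.distrib inner_diff_left prod_nonneg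
        ennreal_mult)
  also have "\<dots> = (\<Prod>b\<in>Basis. \<integral>\<^sup>+y. ?f b y \<partial>lborel)"
    by (rule nn_integral_lborel_prod) simp_all
  also have "\<dots> = (\<Prod>b\<in>Basis. ennreal (normal_density 0 (sqrt (v + w)) (x \<bullet> b)))"
    using conv_normal_density_zero_mean[of "sqrt v" "sqrt w"] assms
    by (intro prod.cong refl) (auto dest!: fun_cong)
  finally show ?thesis
    by (simp add: iso_normal_density_def prod_ennreal)
qed

lemma nn_integral_lborel_translate:
  fixes f :: "'a::euclidean_space \<Rightarrow> ennreal"
  assumes [measurable]: "f \<in> borel_measurable borel"
  shows "(\<integral>\<^sup>+x. f x \<partial>lborel) = (\<integral>\<^sup>+x. f (c + x) \<partial>lborel)"
proof -
  have "(\<integral>\<^sup>+x. f x \<partial>distr lborel borel ((+) c)) = (\<integral>\<^sup>+x. f (c + x) \<partial>lborel)"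
    by (rule nn_integral_distr) simp_all
  then show ?thesis by (simp only: lborel_distr_plus)
qed

lemma gaussian_law_convolution:
  assumes "0 \<le> v" "0 \<le> w"
  shows "distr (gaussian_law v \<Otimes>\<^sub>M gaussian_law w) borel (\<lambda>(x, y). x + y)
    = (gaussian_law (v + w) :: 'a::euclidean_space measure)"
  (is "?L = _")
proof (rule measure_eqI)
  show "sets ?L = sets (gaussian_law (v + w) :: 'a measure)" by simp
next
  fix A assume "A \<in> sets ?L"
  then have [measurable]: "A \<in> sets borel" by simp
  interpret G: prob_space "gaussian_law w :: 'a measure" by simp
  have conv: "emeasure ?L A
      = (\<integral>\<^sup>+x. \<integral>\<^sup>+y. indicator A (x + y) \<partial>gaussian_law w \<partial>gaussian_law v)"
    by (simp add: nn_integral_distr split_beta' G.nn_integral_fst[symmetric] flip: nn_integral_indicator)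
  consider "v = 0" | "w = 0" | "0 < v" "0 < w" using assms by linarith
  then show "emeasure ?L A = emeasure (gaussian_law (v + w)) A"
  proof cases
    case 1
    then show ?thesis
      unfolding conv by (simp add: gaussian_law_0 nn_integral_return)
  next
    case 2
    then show ?thesis
      unfolding conv by (simp add: gaussian_law_0 nn_integral_return)
  next
    case 3
    let ?f = "\<lambda>x::'a. ennreal (iso_normal_density v x)"
    let ?g = "\<lambda>x::'a. ennreal (iso_normal_density w x)"
    have "emeasure ?L A = (\<integral>\<^sup>+x. \<integral>\<^sup>+y. ?g y * (?f x * indicator A (x + y)) \<partial>lborel \<partial>lborel)"
      unfolding conv
      by (simp add: gaussian_law_eq_density 3 nn_integral_density nn_integral_cmult[symmetric]
          ac_simps)
    also have "\<dots> = (\<integral>\<^sup>+y. \<integral>\<^sup>+x. ?g y * (?f x * indicator A (x + y)) \<partial>lborel \<partial>lborel)"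
      by (intro lborel_pair.Fubini') simp
    also have "\<dots> = (\<integral>\<^sup>+y. \<integral>\<^sup>+x. ?f (x - y) * ?g y * indicator A x \<partial>lborel \<partial>lborel)"
    proof (rule nn_integral_cong)
      fix y
      show "(\<integral>\<^sup>+x. ?g y * (?f x * indicator A (x + y)) \<partial>lborel)
        = (\<integral>\<^sup>+x. ?f (x - y) * ?g y * indicator A x \<partial>lborel)"
        using nn_integral_lborel_translate[of "\<lambda>x. ?f (x - y) * ?g y * indicator A x" y]
        by (simp add: ac_simps)
    qed
    also have "\<dots> = (\<integral>\<^sup>+x. \<integral>\<^sup>+y. ?f (x - y) * ?g y * indicator A x \<partial>lborel \<partial>lborel)"
      by (intro lborel_pair.Fubini') simp
    also have "\<dots> = (\<integral>\<^sup>+x. ennreal (iso_normal_density (v + w) x) * indicator A x \<partial>lborel)"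
      by (simp add: nn_integral_multc iso_normal_density_convolution 3)
    also have "\<dots> = emeasure (gaussian_law (v + w)) A"
      using 3 by (simp add: gaussian_law_eq_density emeasure_density)
    finally show ?thesis .
  qed
qed

text \<open>By Cauchy-Schwarz \<open>norm x ^ 4\<close> is at most \<open>DIM('a)\<close> times the sum of the fourth powers of
  the coordinates, and a standard normal coordinate has fourth moment \<open>3\<close>. The order \<open>v\<^sup>2\<close> is
  what makes the chaining argument for Brownian paths work; second moments would be too weak.\<close>

lemma nn_integral_gaussian_law_norm_pow4:
  assumes "0 \<le> v"
  shows "(\<integral>\<^sup>+x. ennreal (norm x ^ 4) \<partial>(gaussian_law v :: 'a::euclidean_space measure))
    \<le> ennreal (3 * real DIM('a) ^ 2 * v\<^sup>2)"
proof -
  have coord: "(\<integral>\<^sup>+x. ennreal ((x \<bullet> i) ^ 4) \<partial>density lborel (iso_normal_density 1 :: 'a \<Rightarrow> real)) = 3"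
    if i: "i \<in> Basis" for i
  proof -
    let ?f = "\<lambda>b y. ennreal (normal_density 0 1 y * (if b = i then y ^ 4 else 1))"
    have m4: "(\<integral>\<^sup>+y. ennreal (normal_density 0 1 y * y ^ 4) \<partial>lborel) = 3"
    proof -
      have "has_bochner_integral lborel (\<lambda>y. normal_density 0 1 y * y ^ 4) 3"
      proof -
        have e: "fact (2 * 2) / ((2 / (1::real)\<^sup>2) ^ 2 * fact 2) = (3::real)"
          by (simp add: fact_numeral)
        have "has_bochner_integral lborel (\<lambda>y. normal_density 0 1 y * (y - 0) ^ (2 * 2)) 3"
          using normal_moment_even[of 1 0 2] unfolding e by simp
        then show ?thesis by simp
      qed
      then have "(\<integral>\<^sup>+y. ennreal (normal_density 0 1 y * y ^ 4) \<partial>lborel) = ennreal 3"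
        by (subst nn_integral_eq_integral) (auto simp: has_bochner_integral_iff)
      then show ?thesis by simp
    qed
    have m0: "(\<integral>\<^sup>+y. ennreal (normal_density 0 1 y) \<partial>lborel) = 1"
      using prob_space.emeasure_space_1[OF prob_space_normal_density[of 1 0]]
      by (simp add: emeasure_density)
    have p: "(\<Prod>b\<in>Basis. if b = i then (x \<bullet> b) ^ 4 else 1) = (x \<bullet> i) ^ 4" for x :: 'a
      using i by simp
    have "(\<integral>\<^sup>+x. ennreal ((x \<bullet> i) ^ 4) \<partial>density lborel (iso_normal_density 1 :: 'a \<Rightarrow> real))
        = (\<integral>\<^sup>+x. (\<Prod>b\<in>Basis. ?f b (x \<bullet> b)) \<partial>lborel)"
      by (simp add: nn_integral_density prod_ennreal prod.distrib p iso_normal_density_def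
          prod_nonneg flip: ennreal_mult)
    also have "\<dots> = (\<Prod>b\<in>Basis. \<integral>\<^sup>+y. ?f b y \<partial>lborel)"
      by (rule nn_integral_lborel_prod) auto
    also have "\<dots> = (\<Prod>b\<in>Basis. if b = i then 3 else 1)"
      by (intro prod.cong refl) (simp add: m4 m0)
    also have "\<dots> = 3"
      using i by simp
    finally show ?thesis .
  qed
  have le: "norm x ^ 4 \<le> real DIM('a) * (\<Sum>i\<in>Basis. (x \<bullet> i) ^ 4)" for x :: 'a
  proof -
    have "norm x ^ 4 = ((norm x)\<^sup>2)\<^sup>2"
      by simp
    also have "\<dots> = (\<Sum>i\<in>Basis. (x \<bullet> i)\<^sup>2)\<^sup>2"
      unfolding power2_norm_eq_inner euclidean_inner[of x x] power2_eq_square[of "x \<bullet> _"] ..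
    also have "\<dots> = (\<Sum>i\<in>Basis. 1 * (x \<bullet> i)\<^sup>2)\<^sup>2" by simp
    also have "\<dots> \<le> (\<Sum>i\<in>(Basis::'a set). 1\<^sup>2) * (\<Sum>i\<in>Basis. ((x \<bullet> i)\<^sup>2)\<^sup>2)"
      by (rule Cauchy_Schwarz_ineq_sum)
    finally show ?thesis by simp
  qed
  have scale: "norm (sqrt v *\<^sub>R x) ^ 4 = v\<^sup>2 * norm x ^ 4" for x :: 'a
  proof -
    have "sqrt v ^ 4 = (sqrt v ^ 2) ^ 2" by (simp only: flip: power_mult) simp
    then show ?thesis using assms by (simp add: power_mult_distrib)
  qed
  have "(\<integral>\<^sup>+x. ennreal (norm x ^ 4) \<partial>(gaussian_law v :: 'a measure))
      = (\<integral>\<^sup>+x. ennreal (v\<^sup>2) * ennreal (norm x ^ 4) \<partial>density lborel (iso_normal_density 1 :: 'a \<Rightarrow> real))"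
    by (simp add: gaussian_law_def nn_integral_distr scale ennreal_mult del: norm_scaleR)
  also have "\<dots> \<le> (\<integral>\<^sup>+x. ennreal (v\<^sup>2) * (ennreal DIM('a) * (\<Sum>i\<in>Basis. ennreal ((x \<bullet> i) ^ 4)))
      \<partial>density lborel (iso_normal_density 1 :: 'a \<Rightarrow> real))"
  proof (intro nn_integral_mono mult_left_mono)
    fix x :: 'a
    have "ennreal (norm x ^ 4) \<le> ennreal (real DIM('a) * (\<Sum>i\<in>Basis. (x \<bullet> i) ^ 4))"
      by (rule ennreal_leI[OF le])
    also have "\<dots> = ennreal (real DIM('a)) * (\<Sum>i\<in>Basis. ennreal ((x \<bullet> i) ^ 4))"
      by (subst ennreal_mult) (simp_all add: sum_nonneg sum_ennreal)
    finally show "ennreal (norm x ^ 4) \<le> ennreal (real DIM('a)) * (\<Sum>i\<in>Basis. ennreal ((x \<bullet> i) ^ 4))" .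
  qed simp
  also have "\<dots> = ennreal (v\<^sup>2) * (ennreal DIM('a) * (\<Sum>i\<in>(Basis::'a set). 3))"
    by (simp add: nn_integral_cmult nn_integral_sum coord del: sum_constant sum_ennreal)
  also have "\<dots> = ennreal (v\<^sup>2) * (ennreal (real DIM('a)) * ennreal (real DIM('a) * 3))"
    by (simp add: ennreal_mult ennreal_of_nat_eq_real_of_nat)
  also have "\<dots> = ennreal (v\<^sup>2 * (real DIM('a) * (real DIM('a) * 3)))"
    by (simp only: ennreal_mult zero_le_power2 of_nat_0_le_iff zero_le_numeral mult_nonneg_nonneg)
  also have "v\<^sup>2 * (real DIM('a) * (real DIM('a) * 3)) = 3 * real DIM('a) ^ 2 * v\<^sup>2"
    by (simp add: power2_eq_square)
  finally show ?thesis .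
qed

section \<open>Gaussian random vectors: sums and almost sure limits\<close>

definition gaussian :: "'w measure \<Rightarrow> real \<Rightarrow> ('w \<Rightarrow> 'a::euclidean_space) \<Rightarrow> bool" where
  "gaussian M v X \<longleftrightarrow> X \<in> borel_measurable M \<and> distr M borel X = gaussian_law v"

lemma gaussian_cong_AE:
  assumes "gaussian M v X" "Y \<in> borel_measurable M" "AE \<omega> in M. X \<omega> = Y \<omega>"
  shows "gaussian M v Y"
  using assms distr_cong_AE[of M M borel borel X Y] by (simp add: gaussian_def)

lemma (in prob_space) gaussian_0_iff:
  fixes X :: "'a \<Rightarrow> 'b::euclidean_space"
  assumes "X \<in> borel_measurable M"
  shows "gaussian M 0 X \<longleftrightarrow> (AE \<omega> in M. X \<omega> = 0)"
proof
  assume X0: "AE \<omega> in M. X \<omega> = 0"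
  have "gaussian M 0 (\<lambda>_. 0 :: 'b)"
    by (simp add: gaussian_def gaussian_law_0 distr_const)
  then show "gaussian M 0 X"
    using assms by (rule gaussian_cong_AE) (use X0 in \<open>auto elim: eventually_mono\<close>)
next
  assume "gaussian M 0 X"
  then have "AE x in distr M borel X. x = 0"
    by (simp only: gaussian_def gaussian_law_0) (simp add: AE_return)
  then show "AE \<omega> in M. X \<omega> = 0"
    using assms by (simp add: AE_distr_iff)
qed

lemma gaussian_scaleR:
  assumes "gaussian M v X" "0 \<le> c"
  shows "gaussian M (c\<^sup>2 * v) (\<lambda>\<omega>. c *\<^sub>R X \<omega>)"
proof -
  have [measurable]: "X \<in> borel_measurable M" and d: "distr M borel X = gaussian_law v"
    using assms by (simp_all add: gaussian_def)
  have "distr M borel (\<lambda>\<omega>. c *\<^sub>R X \<omega>) = distr (distr M borel X) borel (\<lambda>x. c *\<^sub>R x)"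
    by (simp add: distr_distr comp_def)
  also have "\<dots> = gaussian_law (c\<^sup>2 * v)"
    using assms(2) by (simp add: d gaussian_law_def distr_distr comp_def real_sqrt_mult)
  finally show ?thesis by (simp add: gaussian_def)
qed

lemma (in prob_space) gaussian_add:
  assumes "gaussian M v X" "gaussian M w Y" "0 \<le> v" "0 \<le> w" "indep_var borel X borel Y"
  shows "gaussian M (v + w) (\<lambda>\<omega>. X \<omega> + Y \<omega>)"
proof -
  have [measurable]: "X \<in> borel_measurable M" "Y \<in> borel_measurable M"
    using assms by (simp_all add: gaussian_def)
  have "distr M borel (\<lambda>\<omega>. X \<omega> + Y \<omega>)
      = distr (distr M (borel \<Otimes>\<^sub>M borel) (\<lambda>\<omega>. (X \<omega>, Y \<omega>))) borel (\<lambda>(x, y). x + y)"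
    by (simp add: distr_distr comp_def)
  also have "distr M (borel \<Otimes>\<^sub>M borel) (\<lambda>\<omega>. (X \<omega>, Y \<omega>)) = gaussian_law v \<Otimes>\<^sub>M gaussian_law w"
    using assms by (simp add: indep_var_distribution_eq gaussian_def)
  finally show ?thesis
    using assms by (simp add: gaussian_def gaussian_law_convolution)
qed

text \<open>Induction on the index set: a variable is independent of the sum of the others.\<close>

lemma (in prob_space) gaussian_sum:
  assumes "finite I" "indep_vars (\<lambda>_. borel) X I"
    and "\<And>i. i \<in> I \<Longrightarrow> 0 \<le> v i" "\<And>i. i \<in> I \<Longrightarrow> gaussian M (v i) (X i)"
  shows "gaussian M (\<Sum>i\<in>I. v i) (\<lambda>\<omega>. \<Sum>i\<in>I. X i \<omega>)"
  using assms
proof (induction I)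
  case empty
  then show ?case by (simp add: gaussian_0_iff)
next
  case (insert i I)
  have "indep_var
    borel ((\<lambda>f. f i) \<circ> (\<lambda>\<omega>. restrict (\<lambda>i. X i \<omega>) {i}))
    borel ((\<lambda>f. \<Sum>i\<in>I. f i) \<circ> (\<lambda>\<omega>. restrict (\<lambda>i. X i \<omega>) I))"
    using insert.hyps
    by (intro indep_var_compose[OF indep_var_restrict[OF insert.prems(1)]]) auto
  also have "((\<lambda>f. f i) \<circ> (\<lambda>\<omega>. restrict (\<lambda>i. X i \<omega>) {i})) = X i"
    by auto
  also have "((\<lambda>f. \<Sum>i\<in>I. f i) \<circ> (\<lambda>\<omega>. restrict (\<lambda>i. X i \<omega>) I)) = (\<lambda>\<omega>. \<Sum>i\<in>I. X i \<omega>)"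
    by (auto cong: rev_conj_cong)
  finally have "indep_var borel (X i) borel (\<lambda>\<omega>. \<Sum>i\<in>I. X i \<omega>)" .
  moreover have "gaussian M (\<Sum>i\<in>I. v i) (\<lambda>\<omega>. \<Sum>i\<in>I. X i \<omega>)"
    using insert by (intro insert.IH indep_vars_subset[OF insert.prems(1)]) auto
  ultimately show ?case
    using insert by (simp add: gaussian_add sum_nonneg)
qed

text \<open>For an open set \<open>U\<close>, the indicator of \<open>U\<close> is lower semicontinuous, so Fatou's lemma bounds the
  probability that the limit lies in \<open>U\<close> by \<open>\<mu> U\<close>. Outer regularity carries this upper bound over to
  all Borel sets, and for two probability measures a one-sided bound, applied to a set and to its
  complement, is an equality.\<close>

lemma (in prob_space) AE_limit_same_law:
  fixes X :: "nat \<Rightarrow> 'a \<Rightarrow> 'b::{second_countable_topology, complete_space}"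
  assumes X: "\<And>n. X n \<in> borel_measurable M" "\<And>n. distr M borel (X n) = \<mu>"
    and Y [measurable]: "Y \<in> borel_measurable M"
    and lim: "AE \<omega> in M. (\<lambda>n. X n \<omega>) \<longlonglongrightarrow> Y \<omega>"
  shows "distr M borel Y = \<mu>"
proof -
  note X(1)[measurable]
  interpret \<mu>: prob_space \<mu>
    using prob_space_distr[OF X(1)[of 0]] by (simp only: X(2))
  interpret Y: prob_space "distr M borel Y" by (rule prob_space_distr) simp
  have sets_\<mu> [simp, measurable_cong]: "sets \<mu> = sets borel" using arg_cong[OF X(2)[of 0], of sets] by simp
  then have [simp]: "space \<mu> = UNIV" using sets_eq_imp_space_eq[OF sets_\<mu>] by simp
  have open_le: "emeasure (distr M borel Y) U \<le> emeasure \<mu> U" if "open U" for U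
  proof -
    have [measurable]: "U \<in> sets borel" using that by simp
    have "emeasure (distr M borel Y) U = (\<integral>\<^sup>+\<omega>. indicator U (Y \<omega>) \<partial>M)"
      by (simp add: nn_integral_distr flip: nn_integral_indicator)
    also have "\<dots> \<le> (\<integral>\<^sup>+\<omega>. liminf (\<lambda>n. indicator U (X n \<omega>)) \<partial>M)"
    proof (rule nn_integral_mono_AE)
      show "AE \<omega> in M. indicator U (Y \<omega>) \<le> liminf (\<lambda>n. indicator U (X n \<omega>) :: ennreal)"
        using lim
      proof eventually_elim
        case (elim \<omega>)
        show ?case
        proof (cases "Y \<omega> \<in> U")
          case True
          have "\<forall>\<^sub>F n in sequentially. X n \<omega> \<in> U"
            using elim that True by (rule topological_tendstoD)
          then have "\<forall>\<^sub>F n in sequentially. 1 \<le> (indicator U (X n \<omega>) :: ennreal)"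
            by eventually_elim simp
          then show ?thesis
            using True by (simp add: Liminf_bounded)
        qed simp
      qed
    qed
    also have "\<dots> \<le> liminf (\<lambda>n. \<integral>\<^sup>+\<omega>. indicator U (X n \<omega>) \<partial>M)"
      by (rule nn_integral_liminf) simp
    also have "(\<lambda>n. \<integral>\<^sup>+\<omega>. indicator U (X n \<omega>) \<partial>M) = (\<lambda>n. emeasure (distr M borel (X n)) U)"
      by (simp add: nn_integral_distr flip: nn_integral_indicator)
    finally show ?thesis by (simp add: X(2) Liminf_const)
  qed
  have le: "emeasure (distr M borel Y) A \<le> emeasure \<mu> A" if [measurable]: "A \<in> sets borel" for A
  proof -
    have "emeasure (distr M borel Y) A = (INF U\<in>{U. A \<subseteq> U \<and> open U}. emeasure (distr M borel Y) U)"
      by (rule outer_regular) simp_all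
    also have "\<dots> \<le> (INF U\<in>{U. A \<subseteq> U \<and> open U}. emeasure \<mu> U)"
      by (rule INF_mono) (use open_le in blast)
    also have "\<dots> = emeasure \<mu> A"
      by (rule outer_regular[symmetric]) simp_all
    finally show ?thesis .
  qed
  show ?thesis
  proof (rule measure_eqI)
    fix A assume "A \<in> sets (distr M borel Y)"
    then have A [measurable]: "A \<in> sets borel" by simp
    have le': "Y.prob A \<le> \<mu>.prob A" "Y.prob (- A) \<le> \<mu>.prob (- A)"
      using le[of A] le[of "- A"] A by (auto simp: Y.emeasure_eq_measure \<mu>.emeasure_eq_measure)
    have "Y.prob (- A) = 1 - Y.prob A" "\<mu>.prob (- A) = 1 - \<mu>.prob A"
      using Y.prob_compl[of A] \<mu>.prob_compl[of A] A by (simp_all add: Compl_eq_Diff_UNIV)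
    then show "emeasure (distr M borel Y) A = emeasure \<mu> A"
      using le' by (simp add: Y.emeasure_eq_measure \<mu>.emeasure_eq_measure)
  qed simp
qed

text \<open>Rescaling \<open>X n\<close> by \<open>sqrt (w / v n)\<close>, which tends to \<open>1\<close>, gives variables with one and the same
  law and the same almost sure limit. This replaces characteristic functions in dimension
  greater than one.\<close>

lemma (in prob_space) gaussian_limit:
  assumes X: "\<And>n. gaussian M (v n) (X n)" "\<And>n. 0 < v n" and v: "v \<longlonglongrightarrow> w" "0 < w"
    and Y: "Y \<in> borel_measurable M"
    and lim: "AE \<omega> in M. (\<lambda>n. X n \<omega>) \<longlonglongrightarrow> Y \<omega>"
  shows "gaussian M w Y"
proof -
  define c where "c n = sqrt (w / v n)" for n
  have g: "gaussian M w (\<lambda>\<omega>. c n *\<^sub>R X n \<omega>)" for n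
    using gaussian_scaleR[OF X(1)[of n], of "c n"] X(2)[of n] v(2) by (simp add: c_def)
  have "c \<longlonglongrightarrow> sqrt (w / w)"
    unfolding c_def[abs_def] using v by (intro tendsto_intros) auto
  then have c: "c \<longlonglongrightarrow> 1" using v by simp
  have lim': "AE \<omega> in M. (\<lambda>n. c n *\<^sub>R X n \<omega>) \<longlonglongrightarrow> Y \<omega>"
    using lim by eventually_elim (use tendsto_scaleR[OF c] in fastforce)
  have "distr M borel Y = gaussian_law w"
    by (rule AE_limit_same_law[OF _ _ Y lim']) (use g in \<open>simp_all only: gaussian_def\<close>)
  then show ?thesis using Y by (simp only: gaussian_def)
qed

lemma nn_integral_gaussian_norm_pow4:
  fixes X :: "'w \<Rightarrow> 'a::euclidean_space"
  assumes "gaussian M v X" "0 \<le> v"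
  shows "(\<integral>\<^sup>+\<omega>. ennreal (norm (X \<omega>) ^ 4) \<partial>M) \<le> ennreal (3 * real DIM('a) ^ 2 * v\<^sup>2)"
proof -
  have [measurable]: "X \<in> borel_measurable M" using assms by (simp add: gaussian_def)
  have "(\<integral>\<^sup>+\<omega>. ennreal (norm (X \<omega>) ^ 4) \<partial>M) = (\<integral>\<^sup>+x. ennreal (norm x ^ 4) \<partial>distr M borel X)"
    by (simp add: nn_integral_distr)
  with nn_integral_gaussian_law_norm_pow4[OF assms(2), where 'a='a] assms(1) show ?thesis
    by (simp add: gaussian_def)
qed

section \<open>Independence of generated sigma-algebras and of random variables\<close>

text \<open>Independence of generated \<open>\<sigma>\<close>-algebras is transferred to random variables by checking that the
  latter are measurable for the \<open>\<sigma>\<close>-algebra generated by the cylinder events, since sums and multiples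
  are then covered by the usual closure properties of measurable functions.\<close>

lemma measurable_cylinder_sigma:
  assumes "j \<in> J" "\<C> \<subseteq> Pow (space M)" "cylinder_events M X J \<subseteq> \<C>"
  shows "X j \<in> borel_measurable (sigma (space M) \<C>)"
proof (rule measurableI)
  fix A :: "'c set" assume "A \<in> sets borel"
  then have "X j -` A \<inter> space M \<in> \<C>"
    using assms unfolding cylinder_events_def by blast
  then show "X j -` A \<inter> space (sigma (space M) \<C>) \<in> sets (sigma (space M) \<C>)"
    using assms by (simp add: sets_measure_of space_measure_of sigma_sets.Basic)
qed simp

lemma cylinder_events_subset_Pow: "cylinder_events M X J \<subseteq> Pow (space M)"
  by (auto simp: cylinder_events_def)

lemma vimage_in_sigma_sets:
  assumes "X \<in> borel_measurable (sigma (space M) \<C>)" "\<C> \<subseteq> Pow (space M)" "A \<in> sets borel"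
  shows "X -` A \<inter> space M \<in> sigma_sets (space M) \<C>"
  using measurable_sets[OF assms(1,3)] assms(2) by (simp add: space_measure_of sets_measure_of)

lemma (in prob_space) indep_var_from_indep_sigma:
  assumes "indep_set (sigma_sets (space M) \<C>) (sigma_sets (space M) \<D>)"
    and "\<C> \<subseteq> Pow (space M)" "\<D> \<subseteq> Pow (space M)"
    and X: "X \<in> borel_measurable (sigma (space M) \<C>)"
    and Y: "Y \<in> borel_measurable (sigma (space M) \<D>)"
  shows "indep_var borel X borel Y"
proof -
  have ev: "sigma_sets (space M) \<C> \<subseteq> events" "sigma_sets (space M) \<D> \<subseteq> events"
    using assms(1) by (auto simp: indep_set_def indep_sets_def UNIV_bool)
  have X': "X -` A \<inter> space M \<in> sigma_sets (space M) \<C>" 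
    and Y': "Y -` A \<inter> space M \<in> sigma_sets (space M) \<D>" if "A \<in> sets borel" for A
    using that vimage_in_sigma_sets assms by metis+
  have rv: "X \<in> borel_measurable M" "Y \<in> borel_measurable M"
    using X' Y' ev by (auto intro!: measurableI)
  have "sigma_sets (space M) {X -` A \<inter> space M |A. A \<in> sets borel} \<subseteq> sigma_sets (space M) \<C>"
    using X' by (intro sigma_sets_mono) auto
  moreover have "sigma_sets (space M) {Y -` A \<inter> space M |A. A \<in> sets borel} \<subseteq> sigma_sets (space M) \<D>"
    using Y' by (intro sigma_sets_mono) auto
  ultimately have "indep_set (sigma_sets (space M) {X -` A \<inter> space M |A. A \<in> sets borel})
      (sigma_sets (space M) {Y -` A \<inter> space M |A. A \<in> sets borel})"
    unfolding indep_set_def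
    by (intro indep_sets_mono_sets[OF assms(1)[unfolded indep_set_def]]) (auto split: bool.split)
  then show ?thesis
    unfolding indep_var_eq using rv by blast
qed

lemma (in prob_space) indep_vars_from_indep_sigma:
  assumes ind: "indep_sets (\<lambda>i. sigma_sets (space M) (\<C> i)) I"
    and C: "\<And>i. i \<in> I \<Longrightarrow> \<C> i \<subseteq> Pow (space M)"
    and X: "\<And>i. i \<in> I \<Longrightarrow> X i \<in> borel_measurable (sigma (space M) (\<C> i))"
  shows "indep_vars (\<lambda>_. borel) X I"
proof -
  have X': "X i -` A \<inter> space M \<in> sigma_sets (space M) (\<C> i)" if "A \<in> sets borel" "i \<in> I" for A i
    using that vimage_in_sigma_sets assms by metis
  have "X i \<in> borel_measurable M" if "i \<in> I" for i
    using X' ind that by (auto simp: indep_sets_def intro!: measurableI)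
  then show ?thesis
    unfolding indep_vars_def2 using X' by (auto intro!: indep_sets_mono_sets[OF ind])
qed

text \<open>The closed form of the product, for comparison with the matrix form of the normal density.\<close>

lemma iso_normal_density_eq:
  fixes x :: "'a::euclidean_space"
  assumes "0 < v"
  shows "iso_normal_density v x = exp (- (x \<bullet> x) / (2 * v)) / sqrt ((2 * pi * v) ^ DIM('a))"
proof -
  have "(\<Sum>b\<in>Basis. - ((x \<bullet> b)\<^sup>2 / (2 * v))) = - (x \<bullet> x) / (2 * v)"
    by (subst (2) euclidean_inner) (simp add: power2_eq_square sum_negf sum_divide_distrib)
  moreover have "iso_normal_density v x
      = exp (\<Sum>b\<in>Basis. - ((x \<bullet> b)\<^sup>2 / (2 * v))) / sqrt (2 * pi * v) ^ DIM('a)"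
    using assms by (simp add: iso_normal_density_def normal_density_def prod_dividef exp_sum)
  ultimately show ?thesis
    by (simp add: real_sqrt_power)
qed

lemma multivariate_normal_iff_gaussian:
  fixes X :: "'w \<Rightarrow> real ^ 'n"
  assumes "0 < v"
  shows "multivariate_normal M X 0 (v *\<^sub>R mat 1) \<longleftrightarrow> gaussian M v X"
proof -
  let ?I = "mat 1 :: real ^ 'n ^ 'n"
  have "(v *\<^sub>R ?I) ** ((1 / v) *\<^sub>R ?I) = mat 1" "((1 / v) *\<^sub>R ?I) ** (v *\<^sub>R ?I) = mat 1"
    using assms by (simp_all add: matrix_scalar_ac flip: scalar_matrix_assoc)
  then have "\<exists>B. (v *\<^sub>R ?I) ** B = mat 1 \<and> B ** (v *\<^sub>R ?I) = mat 1"
    by blast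
  from someI_ex[OF this] have "(v *\<^sub>R ?I) ** matrix_inv (v *\<^sub>R ?I) = mat 1"
    unfolding matrix_inv_def by blast
  then have "v *\<^sub>R matrix_inv (v *\<^sub>R ?I) = ?I"
    by (simp flip: scalar_matrix_assoc)
  then have "(1 / v) *\<^sub>R (v *\<^sub>R matrix_inv (v *\<^sub>R ?I)) = (1 / v) *\<^sub>R ?I"
    by (rule arg_cong)
  then have inv: "matrix_inv (v *\<^sub>R ?I) = (1 / v) *\<^sub>R ?I"
    using assms by simp
  have det: "det (v *\<^sub>R ?I) = v ^ CARD('n)"
    by (subst det_diagonal) (simp_all add: mat_def)
  have "multivariate_normal_density 0 (v *\<^sub>R mat 1) x = iso_normal_density v x" for x :: "real ^ 'n"
    using assms
    by (simp add: multivariate_normal_density_def iso_normal_density_eq inv det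
        power_mult_distrib flip: scaleR_matrix_vector_assoc)
  then show ?thesis
    using assms unfolding multivariate_normal_def distributed_def gaussian_def
    by (auto simp: gaussian_law_eq_density cong: distr_cong)
qed

section \<open>Pathwise estimates: chaining and Ornstein-Uhlenbeck equations\<close>

text \<open>Approximate \<open>t\<close> from below by the dyadic points \<open>\<tau> n = a + \<lfloor>(t - a) 2 ^ n\<rfloor> / 2 ^ n\<close>. Two consecutive
  approximations agree or are neighbours on the grid of level \<open>n + 1\<close>, so the increments of \<open>f\<close>
  along them are dominated by \<open>q\<close>; continuity gives the bound at \<open>t\<close>.\<close>

lemma chaining_bound:
  fixes f :: "real \<Rightarrow> 'a::real_normed_vector"
  assumes cont: "continuous_on {a..<a + 1} f"
    and inc: "\<And>n k. k + 1 < 2 ^ n \<Longrightarrow> norm (f (a + real (k + 1) / 2 ^ n) - f (a + real k / 2 ^ n)) \<le> q n"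
    and q: "summable q" "\<And>n. 0 \<le> q n"
    and t: "t \<in> {a..<a + 1}"
  shows "norm (f t - f a) \<le> suminf q"
proof -
  define x where "x = t - a"
  have x: "0 \<le> x" "x < 1" using t by (auto simp: x_def)
  define k where "k n = nat \<lfloor>x * 2 ^ n\<rfloor>" for n :: nat
  define \<tau> where "\<tau> n = a + real (k n) / 2 ^ n" for n
  have k: "real (k n) \<le> x * 2 ^ n" "x * 2 ^ n < real (k n) + 1" for n
    using x unfolding k_def by (simp_all add: of_nat_nat)
  have "real (k n) / 2 ^ n \<le> x" "x < (real (k n) + 1) / 2 ^ n" for n
    using k[of n] by (simp_all add: pos_divide_le_eq pos_less_divide_eq)
  note k_div = this
  have \<tau>_le: "\<tau> n \<le> t" and \<tau>_ge: "a \<le> \<tau> n" and \<tau>_gt: "t - 1 / 2 ^ n \<le> \<tau> n" for n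
    using k_div[of n] by (auto simp: \<tau>_def x_def add_divide_distrib)
  have step: "norm (f (\<tau> (Suc n)) - f (\<tau> n)) \<le> q (Suc n)" for n
  proof -
    have "real (k (Suc n)) < 2 * real (k n) + 2" "2 * real (k n) < real (k (Suc n)) + 1"
      using k[of n] k[of "Suc n"] by (auto simp: algebra_simps)
    then have "k (Suc n) = 2 * k n \<or> k (Suc n) = 2 * k n + 1" by linarith
    then show ?thesis
    proof
      assume "k (Suc n) = 2 * k n"
      then have "\<tau> (Suc n) = \<tau> n" by (simp add: \<tau>_def)
      then show ?thesis using q by simp
    next
      assume *: "k (Suc n) = 2 * k n + 1"
      have "x * 2 ^ Suc n < 1 * 2 ^ Suc n" using x by (intro mult_strict_right_mono) auto
      then have "real (k (Suc n)) < 2 ^ Suc n" using k(1)[of "Suc n"] by linarith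
      then have "2 * k n + 1 < 2 ^ Suc n"
        by (simp only: of_nat_less_numeral_power_cancel_iff *)
      from inc[OF this] show ?thesis using * by (simp add: \<tau>_def)
    qed
  qed
  have bound: "norm (f (\<tau> n) - f a) \<le> (\<Sum>j\<le>n. q j)" for n
  proof (induction n)
    case 0
    have "k 0 = 0" using x by (simp add: k_def floor_eq_iff)
    then show ?case using q by (simp add: \<tau>_def)
  next
    case (Suc n)
    have "norm (f (\<tau> (Suc n)) - f a) \<le> norm (f (\<tau> (Suc n)) - f (\<tau> n)) + norm (f (\<tau> n) - f a)"
      by (metis add.commute diff_add_cancel norm_triangle_ineq add_diff_eq)
    then show ?case using Suc step[of n] by simp
  qed
  have "(\<lambda>n. t - 1 / 2 ^ n) \<longlonglongrightarrow> t - 0"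
    by (intro tendsto_diff tendsto_const LIMSEQ_divide_realpow_zero) simp
  then have "\<tau> \<longlonglongrightarrow> t"
    by (intro tendsto_sandwich[of "\<lambda>n. t - 1 / 2 ^ n" \<tau> _ "\<lambda>_. t"]) (use \<tau>_gt \<tau>_le in auto)
  then have "(\<lambda>n. f (\<tau> n)) \<longlonglongrightarrow> f t"
    using cont t \<tau>_le \<tau>_ge
    by (intro continuous_on_tendsto_compose[OF cont])
      (auto intro!: always_eventually intro: le_less_trans)
  then have "(\<lambda>n. norm (f (\<tau> n) - f a)) \<longlonglongrightarrow> norm (f t - f a)"
    by (intro tendsto_intros)
  moreover have "norm (f (\<tau> n) - f a) \<le> suminf q" for n
    using bound[of n] sum_le_suminf[OF q(1), of "{..n}"] q(2) by (meson finite_atMost order_trans)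
  ultimately show ?thesis
    by (intro LIMSEQ_le_const2) auto
qed

text \<open>An integration by parts for the stochastic integral of \<open>exp (b r)\<close> against \<open>B\<close> that needs no
  differentiability of \<open>B\<close>. The noise is frozen at its final value:
  \<open>G r = exp (b r) (A r + B t - B r)\<close> is differentiable because \<open>A - B\<close> is, and its derivative
  \<open>b exp (b r) (B t - B r)\<close> is controlled by the oscillation of \<open>B\<close>. Over a short interval the
  weighted increment of \<open>A\<close> is therefore \<open>exp (b s) (B t - B s)\<close> up to an error of smaller order than
  the length.\<close>

lemma weighted_increment_bound:
  fixes A B :: "real \<Rightarrow> 'a::euclidean_space"
  assumes A: "continuous_on {s..t} A" and st: "s \<le> t" and b: "b \<le> 0"
    and eq: "\<And>r. r \<in> {s..t} \<Longrightarrow> A r = A s + (B r - B s) - b *\<^sub>R integral {s..r} A"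
    and \<epsilon>: "\<And>r. r \<in> {s..t} \<Longrightarrow> norm (B t - B r) \<le> \<epsilon>"
  shows "norm (exp (b * t) *\<^sub>R A t - exp (b * s) *\<^sub>R A s - exp (b * s) *\<^sub>R (B t - B s))
    \<le> \<bar>b\<bar> * exp (b * s) * \<epsilon> * (t - s)"
proof -
  define D where "D r = A s - B s - b *\<^sub>R integral {s..r} A" for r
  have D: "D r = A r - B r" if "r \<in> {s..t}" for r
    using eq[OF that] by (simp add: D_def)
  define G where "G r = exp (b * r) *\<^sub>R (D r + B t)" for r
  have D': "(D has_vector_derivative - (b *\<^sub>R A r)) (at r within {s..t})" if "r \<in> {s..t}" for r
  proof -
    have "((\<lambda>r. integral {s..r} A) has_vector_derivative A r) (at r within {s..t})"
      using A that by (rule integral_has_vector_derivative)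
    then show ?thesis
      unfolding D_def by (auto intro!: derivative_eq_intros)
  qed
  have "(G has_vector_derivative (b * exp (b * r)) *\<^sub>R (B t - B r)) (at r within {s..t})"
    if r: "r \<in> {s..t}" for r
  proof -
    have "((\<lambda>r. exp (b * r)) has_vector_derivative b * exp (b * r)) (at r within {s..t})"
      unfolding has_real_derivative_iff_has_vector_derivative[symmetric]
      by (auto intro!: derivative_eq_intros)
    then have "(G has_vector_derivative
        exp (b * r) *\<^sub>R (- (b *\<^sub>R A r)) + (b * exp (b * r)) *\<^sub>R (D r + B t)) (at r within {s..t})"
      unfolding G_def
      by (intro has_vector_derivative_scaleR)
        (auto intro!: derivative_eq_intros D' r simp: has_real_derivative_iff_has_vector_derivative)
    also have "exp (b * r) *\<^sub>R (- (b *\<^sub>R A r)) + (b * exp (b * r)) *\<^sub>R (D r + B t)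
        = (b * exp (b * r)) *\<^sub>R (B t - B r)"
      by (simp add: D[OF r] algebra_simps)
    finally show ?thesis .
  qed
  then have "((\<lambda>r. (b * exp (b * r)) *\<^sub>R (B t - B r)) has_integral (G t - G s)) {s..t}"
    using st by (intro fundamental_theorem_of_calculus)
  moreover have "norm ((b * exp (b * r)) *\<^sub>R (B t - B r)) \<le> \<bar>b\<bar> * exp (b * s) * \<epsilon>"
    if "r \<in> {s..t}" for r
  proof -
    have "exp (b * r) \<le> exp (b * s)"
      using that b by (simp add: mult_left_mono_neg)
    then have "\<bar>b\<bar> * exp (b * r) * norm (B t - B r) \<le> \<bar>b\<bar> * exp (b * s) * \<epsilon>"
      using \<epsilon>[OF that] by (intro mult_mono mult_left_mono) auto
    then show ?thesis by (simp add: abs_mult)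
  qed
  moreover have "0 \<le> \<epsilon>" using \<epsilon>[of t] st by simp
  ultimately have "norm (G t - G s) \<le> \<bar>b\<bar> * exp (b * s) * \<epsilon> * measure lborel {s..t}"
    by (intro has_integral_bound_real[where f="\<lambda>r. (b * exp (b * r)) *\<^sub>R (B t - B r)"]) auto
  moreover have "G t - G s = exp (b * t) *\<^sub>R A t - exp (b * s) *\<^sub>R A s - exp (b * s) *\<^sub>R (B t - B s)"
    using st by (simp add: G_def D algebra_simps)
  ultimately show ?thesis using st by simp
qed

text \<open>The Markov property of the equation: it may be restarted at any intermediate time.\<close>

lemma restart_integral_equation:
  fixes A B :: "real \<Rightarrow> 'a::euclidean_space"
  assumes A: "continuous_on {a..t} A"
    and eq: "\<And>r. r \<in> {a..t} \<Longrightarrow> A r = A a + (B r - B a) - b *\<^sub>R integral {a..r} A"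
    and s: "a \<le> s" and r: "r \<in> {s..t}"
  shows "A r = A s + (B r - B s) - b *\<^sub>R integral {s..r} A"
proof -
  have "A integrable_on {a..r}"
    using A r by (intro integrable_continuous_real continuous_on_subset[OF A]) auto
  then have "integral {a..s} A + integral {s..r} A = integral {a..r} A"
    using s r by (intro Henstock_Kurzweil_Integration.integral_combine) auto
  then have "b *\<^sub>R integral {a..r} A = b *\<^sub>R integral {a..s} A + b *\<^sub>R integral {s..r} A"
    by (metis scaleR_add_right)
  then show ?thesis
    using eq[of r] eq[of s] s r by simp
qed

text \<open>The weighted increment of \<open>A\<close> is the Wiener integral of \<open>exp (b r)\<close> against \<open>B\<close>, obtained here
  pathwise as a limit of Riemann sums: telescope over an equidistant grid and sum the errors of the
  preceding bound, where uniform continuity of \<open>B\<close> makes the oscillation on each cell small.\<close>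

lemma weighted_riemann_sums_converge:
  fixes A B :: "real \<Rightarrow> 'a::euclidean_space"
  assumes A: "continuous_on {a..t} A" and B: "continuous_on {a..t} B" and at: "a \<le> t" and b: "b \<le> 0"
    and eq: "\<And>r. r \<in> {a..t} \<Longrightarrow> A r = A a + (B r - B a) - b *\<^sub>R integral {a..r} A"
  defines "\<tau> \<equiv> \<lambda>K k. a + real k * ((t - a) / real (Suc K))"
  shows "(\<lambda>K. \<Sum>k<Suc K. exp (b * \<tau> K k) *\<^sub>R (B (\<tau> K (Suc k)) - B (\<tau> K k)))
    \<longlonglongrightarrow> exp (b * t) *\<^sub>R A t - exp (b * a) *\<^sub>R A a" (is "?S \<longlonglongrightarrow> ?L")
proof (rule LIMSEQ_I)
  fix e :: real assume "0 < e"
  \<comment> \<open>The summand \<open>1\<close> makes the constant positive and the final estimate strict.\<close>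
  define C where "C = \<bar>b\<bar> * exp (b * a) * (t - a) + 1"
  have C: "0 < C" using at by (simp add: C_def add_nonneg_pos)
  define \<epsilon> where "\<epsilon> = e / C"
  have \<epsilon>: "0 < \<epsilon>" using \<open>0 < e\<close> C by (simp add: \<epsilon>_def)
  have "uniformly_continuous_on {a..t} B"
    using B by (intro compact_uniformly_continuous) auto
  then obtain \<delta> where \<delta>: "0 < \<delta>"
      "\<And>x y. x \<in> {a..t} \<Longrightarrow> y \<in> {a..t} \<Longrightarrow> dist x y < \<delta> \<Longrightarrow> dist (B x) (B y) < \<epsilon>"
    using \<epsilon> unfolding uniformly_continuous_on_def by metis
  obtain K0 where K0: "(t - a) / \<delta> < real K0" using reals_Archimedean2 by blast
  have "norm (?S K - ?L) < e" if K: "K0 \<le> K" for K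
  proof -
    define h where "h = (t - a) / real (Suc K)"
    have h: "0 \<le> h" using at by (simp add: h_def)
    have "(t - a) / \<delta> < real (Suc K)" using K0 K by linarith
    then have h\<delta>: "h < \<delta>" using \<delta>(1) by (simp add: h_def field_simps)
    have \<tau>: "\<tau> K k = a + real k * h" for k by (simp add: \<tau>_def h_def)
    have Suc_\<tau>: "\<tau> K (Suc k) = \<tau> K k + h" for k by (simp add: \<tau> algebra_simps)
    have last: "\<tau> K (Suc K) = t" by (simp add: \<tau>_def)
    have range: "a \<le> \<tau> K k" "k \<le> Suc K \<Longrightarrow> \<tau> K k \<le> t" for k
    proof -
      show "a \<le> \<tau> K k" using h by (simp add: \<tau>)
      assume "k \<le> Suc K"
      then have "real k * h \<le> real (Suc K) * h" using h by (intro mult_right_mono) auto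
      then show "\<tau> K k \<le> t" using last by (simp add: \<tau>)
    qed
    let ?Y = "\<lambda>k. exp (b * \<tau> K k) *\<^sub>R A (\<tau> K k)"
    let ?D = "\<lambda>k. exp (b * \<tau> K k) *\<^sub>R (B (\<tau> K (Suc k)) - B (\<tau> K k))"
    have inc: "norm (?Y (Suc k) - ?Y k - ?D k) \<le> \<bar>b\<bar> * exp (b * a) * \<epsilon> * h" if k: "k < Suc K" for k
    proof -
      have kr: "\<tau> K (Suc k) \<le> t" "\<tau> K k \<le> t" using range(2)[of "Suc k"] range(2)[of k] k by auto
      have "norm (?Y (Suc k) - ?Y k - ?D k)
          \<le> \<bar>b\<bar> * exp (b * \<tau> K k) * \<epsilon> * (\<tau> K (Suc k) - \<tau> K k)"
      proof (rule weighted_increment_bound)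
        show "continuous_on {\<tau> K k..\<tau> K (Suc k)} A"
          using range(1)[of k] kr by (intro continuous_on_subset[OF A]) auto
        show "\<tau> K k \<le> \<tau> K (Suc k)" using h by (simp add: Suc_\<tau>)
        show "b \<le> 0" by (rule b)
        show "A r = A (\<tau> K k) + (B r - B (\<tau> K k)) - b *\<^sub>R integral {\<tau> K k..r} A"
          if "r \<in> {\<tau> K k..\<tau> K (Suc k)}" for r
          using that kr by (intro restart_integral_equation[OF A eq range(1)]) auto
        show "norm (B (\<tau> K (Suc k)) - B r) \<le> \<epsilon>" if "r \<in> {\<tau> K k..\<tau> K (Suc k)}" for r
        proof -
          have "dist (\<tau> K (Suc k)) r < \<delta>"
            using that h\<delta> by (auto simp: dist_real_def Suc_\<tau>)
          then show ?thesis
            using \<delta>(2)[of "\<tau> K (Suc k)" r] that kr range(1)[of k] range(1)[of "Suc k"]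
            by (auto simp: dist_norm intro: less_imp_le)
        qed
      qed
      also have "\<dots> = \<bar>b\<bar> * exp (b * \<tau> K k) * \<epsilon> * h" by (simp add: Suc_\<tau>)
      also have "\<dots> \<le> \<bar>b\<bar> * exp (b * a) * \<epsilon> * h"
        using h \<epsilon> b range(1)[of k]
        by (intro mult_right_mono mult_left_mono) (auto simp: mult_left_mono_neg)
      finally show ?thesis .
    qed
    have "?L = (\<Sum>k<Suc K. ?Y (Suc k) - ?Y k)"
      by (subst sum_lessThan_telescope) (simp add: last, simp add: \<tau>)
    then have "norm (?S K - ?L) = norm (\<Sum>k<Suc K. ?Y (Suc k) - ?Y k - ?D k)"
      by (simp add: norm_minus_commute sum_subtractf del: sum.lessThan_Suc)
    also have "\<dots> \<le> (\<Sum>k<Suc K. \<bar>b\<bar> * exp (b * a) * \<epsilon> * h)"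
      using inc by (intro sum_norm_le) auto
    also have "\<dots> = \<epsilon> * (\<bar>b\<bar> * exp (b * a) * (t - a))"
      by (simp add: h_def del: sum.lessThan_Suc)
    also have "\<dots> < \<epsilon> * C" using \<epsilon> by (simp add: C_def)
    also have "\<dots> = e" using C by (simp add: \<epsilon>_def)
    finally show ?thesis .
  qed
  then show "\<exists>K0. \<forall>K\<ge>K0. norm (?S K - ?L) < e" by blast
qed

section \<open>The equation of the center of mass\<close>

text \<open>The noise that drives the center of mass on \<open>[m, m + 1)\<close>. The values at time \<open>m\<close> are subtracted
  because Brownian motions vanish at their starting time only almost surely, while
  \<open>mean_noise W m (real m)\<close> is \<open>0\<close> everywhere.\<close>

definition mean_noise ::
    "(nat \<Rightarrow> nat \<Rightarrow> real \<Rightarrow> 'w \<Rightarrow> real ^ 'n) \<Rightarrow> nat \<Rightarrow> real \<Rightarrow> 'w \<Rightarrow> real ^ 'n" where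
  "mean_noise W m t \<omega> = (1 / 2 ^ m) *\<^sub>R (\<Sum>i = 1..2 ^ m. W m i t \<omega> - W m i (real m) \<omega>)"

lemma mean_noise_start: "mean_noise W m (real m) \<omega> = 0"
  by (simp add: mean_noise_def)

lemma num_particles_eq: "t \<in> {real m..<real m + 1} \<Longrightarrow> num_particles t = 2 ^ m"
proof -
  assume "t \<in> {real m..<real m + 1}"
  then have "\<lfloor>t\<rfloor> = int m" by (auto simp: floor_eq_iff)
  then show ?thesis by (simp add: num_particles_def)
qed

lemma center_of_mass_eq:
  "t \<in> {real m..<real m + 1} \<Longrightarrow> center_of_mass Z t \<omega> = (1 / 2 ^ m) *\<^sub>R (\<Sum>i = 1..2 ^ m. Z t i \<omega>)"
  by (simp add: center_of_mass_def num_particles_eq)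

lemma (in interacting_branching_diffusion) AE_center_of_mass_continuous:
  "AE \<omega> in M. continuous_on {real m..<real m + 1} (\<lambda>t. center_of_mass Z t \<omega>)"
proof -
  have "AE \<omega> in M. \<forall>i\<in>{1..2 ^ m}. continuous_on {real m..<real m + 1} (\<lambda>t. Z t i \<omega>)"
    by (intro AE_finite_allI continuous_motion) auto
  then show ?thesis
  proof eventually_elim
    case (elim \<omega>)
    have "continuous_on {real m..<real m + 1} (\<lambda>t. (1 / 2 ^ m) *\<^sub>R (\<Sum>i = 1..2 ^ m. Z t i \<omega>))"
      using elim by (intro continuous_intros) auto
    then show ?case
      by (subst continuous_on_cong[OF refl center_of_mass_eq])
  qed
qed

lemma (in interacting_branching_diffusion) AE_mean_noise_continuous:
  "AE \<omega> in M. continuous_on {real m..<real m + 1} (\<lambda>t. mean_noise W m t \<omega>)"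
proof -
  have "AE \<omega> in M. \<forall>i\<in>{1..2 ^ m}. continuous_on {real m..<real m + 1} (\<lambda>t. W m i t \<omega>)"
    using brownian by (intro AE_finite_allI) (auto simp: standard_brownian_motion_on_def)
  then show ?thesis
    by eventually_elim (auto simp: mean_noise_def intro!: continuous_intros)
qed

text \<open>The interaction is antisymmetric in the two particles, so the particles exert no total force.\<close>

lemma interaction_drift_cancels:
  fixes z :: "nat \<Rightarrow> 'a::real_vector"
  shows "(\<Sum>i\<in>I. c *\<^sub>R (\<Sum>j\<in>I. g *\<^sub>R (z j - z i))) = 0"
proof -
  have "(\<Sum>i\<in>I. \<Sum>j\<in>I. z j - z i) = (\<Sum>i\<in>I. \<Sum>j\<in>I. z j) - (\<Sum>j\<in>I. \<Sum>i\<in>I. z j)"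
    by (simp add: sum_subtractf)
  also have "\<dots> = 0" by (subst sum.swap) simp
  finally have "c *\<^sub>R g *\<^sub>R (\<Sum>i\<in>I. \<Sum>j\<in>I. z j - z i) = 0" by simp
  then show ?thesis by (simp only: scaleR_sum_right)
qed

text \<open>Averaging the equations of the particles, the interaction terms cancel and an
  Ornstein-Uhlenbeck equation remains.\<close>

lemma (in interacting_branching_diffusion) AE_center_of_mass_motion:
  "AE \<omega> in M. \<forall>t\<in>{real m..<real m + 1}. center_of_mass Z t \<omega>
     = center_of_mass Z (real m) \<omega> + mean_noise W m t \<omega>
       - b *\<^sub>R integral {real m..t} (\<lambda>s. center_of_mass Z s \<omega>)"
proof -
  let ?n = "2 ^ m :: nat" and ?c = "1 / 2 ^ m :: real"
  let ?drift = "\<lambda>\<omega> i s. - b *\<^sub>R Z s i \<omega> + ?c *\<^sub>R (\<Sum>j = 1..?n. \<gamma> *\<^sub>R (Z s j \<omega> - Z s i \<omega>))"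
  have "AE \<omega> in M. \<forall>i\<in>{1..?n}. continuous_on {real m..<real m + 1} (\<lambda>t. Z t i \<omega>)"
    by (intro AE_finite_allI continuous_motion) auto
  moreover have "AE \<omega> in M. \<forall>i\<in>{1..?n}. \<forall>t\<in>{real m..<real m + 1}.
      Z t i \<omega> = Z (real m) i \<omega> + (W m i t \<omega> - W m i (real m) \<omega>) + integral {real m..t} (?drift \<omega> i)"
    by (intro AE_finite_allI motion) auto
  ultimately show ?thesis
  proof eventually_elim
    case (elim \<omega>)
    show ?case
    proof
      fix t assume t: "t \<in> {real m..<real m + 1}"
      have m: "real m \<in> {real m..<real m + 1}" by simp
      have cont: "continuous_on {real m..t} (\<lambda>s. Z s i \<omega>)" if "i \<in> {1..?n}" for i
        by (rule continuous_on_subset[OF elim(1)[rule_format, OF that]]) (use t in auto)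
      have drift: "?drift \<omega> i integrable_on {real m..t}" if "i \<in> {1..?n}" for i
        using that by (intro integrable_continuous_real continuous_intros cont) auto
      have "(\<Sum>i = 1..?n. integral {real m..t} (?drift \<omega> i))
          = integral {real m..t} (\<lambda>s. \<Sum>i = 1..?n. ?drift \<omega> i s)"
        using drift by (intro integral_sum[symmetric]) auto
      also have "\<dots> = integral {real m..t} (\<lambda>s. (- b * 2 ^ m) *\<^sub>R center_of_mass Z s \<omega>)"
      proof (rule Henstock_Kurzweil_Integration.integral_cong)
        fix s assume "s \<in> {real m..t}"
        then have s: "s \<in> {real m..<real m + 1}" using t by auto
        show "(\<Sum>i = 1..?n. ?drift \<omega> i s) = (- b * 2 ^ m) *\<^sub>R center_of_mass Z s \<omega>"
          unfolding sum.distrib interaction_drift_cancels center_of_mass_eq[OF s]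
          by (simp add: scaleR_sum_right)
      qed
      also have "\<dots> = (- b * 2 ^ m) *\<^sub>R integral {real m..t} (\<lambda>s. center_of_mass Z s \<omega>)"
        by simp
      finally have int: "?c *\<^sub>R (\<Sum>i = 1..?n. integral {real m..t} (?drift \<omega> i))
          = - b *\<^sub>R integral {real m..t} (\<lambda>s. center_of_mass Z s \<omega>)"
        by simp
      have "center_of_mass Z t \<omega> = ?c *\<^sub>R (\<Sum>i = 1..?n. Z (real m) i \<omega>
          + (W m i t \<omega> - W m i (real m) \<omega>) + integral {real m..t} (?drift \<omega> i))"
        unfolding center_of_mass_eq[OF t]
        using elim(2) t by (intro arg_cong[where f="(*\<^sub>R) ?c"] sum.cong refl) blast
      also have "\<dots> = center_of_mass Z (real m) \<omega> + mean_noise W m t \<omega>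
          + ?c *\<^sub>R (\<Sum>i = 1..?n. integral {real m..t} (?drift \<omega> i))"
        unfolding center_of_mass_eq[OF m] mean_noise_def sum.distrib scaleR_add_right ..
      finally show "center_of_mass Z t \<omega> = center_of_mass Z (real m) \<omega> + mean_noise W m t \<omega>
          - b *\<^sub>R integral {real m..t} (\<lambda>s. center_of_mass Z s \<omega>)"
        unfolding int by simp
    qed
  qed
qed

text \<open>Every parent has exactly two children, both placed at its final position, so doubling the
  population leaves the average unchanged, whatever the labelling.\<close>

lemma (in interacting_branching_diffusion) AE_center_of_mass_left_limit:
  "AE \<omega> in M. ((\<lambda>t. center_of_mass Z t \<omega>) \<longlongrightarrow> center_of_mass Z (real (Suc m)) \<omega>)
     (at_left (real (Suc m)))"
proof -
  let ?n = "2 ^ m :: nat" and ?n' = "2 ^ Suc m :: nat"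
  have "AE \<omega> in M. \<forall>i\<in>{1..?n'}. ((\<lambda>t. Z t (p m i \<omega>) \<omega>) \<longlongrightarrow> Z (real (Suc m)) i \<omega>) (at_left (real (Suc m)))"
    by (intro AE_finite_allI offspring_position) auto
  then show ?thesis
    using two_offspring[of m]
  proof eventually_elim
    case (elim \<omega>)
    have "(\<Sum>i = 1..?n'. Z t (p m i \<omega>) \<omega>) = 2 *\<^sub>R (\<Sum>j = 1..?n. Z t j \<omega>)" for t
    proof -
      have "(\<Sum>i = 1..?n'. Z t (p m i \<omega>) \<omega>)
          = (\<Sum>j = 1..?n. \<Sum>i\<in>{i \<in> {1..?n'}. p m i \<omega> = j}. Z t (p m i \<omega>) \<omega>)"
        using elim(2) by (intro sum.group[symmetric]) auto
      also have "\<dots> = (\<Sum>j = 1..?n. \<Sum>i\<in>{i \<in> {1..?n'}. p m i \<omega> = j}. Z t j \<omega>)"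
        by (intro sum.cong refl) auto
      also have "\<dots> = (\<Sum>j = 1..?n. 2 *\<^sub>R Z t j \<omega>)"
        using elim(2) by (intro sum.cong refl) (simp add: sum_constant_scaleR del: sum_constant)
      finally show ?thesis by (simp add: scaleR_sum_right)
    qed
    then have eq: "(1 / 2 ^ Suc m) *\<^sub>R (\<Sum>i = 1..?n'. Z t (p m i \<omega>) \<omega>) = center_of_mass Z t \<omega>"
      if "t \<in> {real m..<real m + 1}" for t
      using that by (simp add: center_of_mass_eq)
    have "((\<lambda>t. (1 / 2 ^ Suc m) *\<^sub>R (\<Sum>i = 1..?n'. Z t (p m i \<omega>) \<omega>))
        \<longlongrightarrow> (1 / 2 ^ Suc m) *\<^sub>R (\<Sum>i = 1..?n'. Z (real (Suc m)) i \<omega>)) (at_left (real (Suc m)))"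
      using elim(1) by (intro tendsto_intros) auto
    also have "(1 / 2 ^ Suc m) *\<^sub>R (\<Sum>i = 1..?n'. Z (real (Suc m)) i \<omega>)
        = center_of_mass Z (real (Suc m)) \<omega>"
      by (subst center_of_mass_eq[of _ "Suc m"]) auto
    finally show ?case
    proof (rule Lim_transform_eventually)
      have "\<forall>\<^sub>F t in at_left (real (Suc m)). t \<in> {real m<..<real (Suc m)}"
        by (rule eventually_at_leftI[of "real m"]) auto
      then show "\<forall>\<^sub>F t in at_left (real (Suc m)).
          (1 / 2 ^ Suc m) *\<^sub>R (\<Sum>i = 1..?n'. Z t (p m i \<omega>) \<omega>) = center_of_mass Z t \<omega>"
        by eventually_elim (rule eq, auto)
    qed
  qed
qed

section \<open>The law of the weighted center of mass\<close>

text \<open>The Wiener integral of a step function.\<close>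

lemma (in prob_space) brownian_weighted_sum_gaussian:
  fixes W :: "real \<Rightarrow> 'a \<Rightarrow> real ^ 'n"
  assumes W: "standard_brownian_motion_on M a c W"
    and \<tau>: "\<And>k. k \<le> K \<Longrightarrow> \<tau> k \<in> {a..<c}" "\<And>k. k < K \<Longrightarrow> \<tau> k < \<tau> (Suc k)"
    and w: "\<And>k. k < K \<Longrightarrow> 0 \<le> w k"
  shows "gaussian M (\<Sum>k<K. (w k)\<^sup>2 * (\<tau> (Suc k) - \<tau> k))
    (\<lambda>\<omega>. \<Sum>k<K. w k *\<^sub>R (W (\<tau> (Suc k)) \<omega> - W (\<tau> k) \<omega>))"
proof (rule gaussian_sum)
  have "indep_vars (\<lambda>_. borel) (\<lambda>k \<omega>. W (\<tau> (Suc k)) \<omega> - W (\<tau> k) \<omega>) {..<K}"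
    using W \<tau> unfolding standard_brownian_motion_on_def by (simp add: less_imp_le)
  then show "indep_vars (\<lambda>_. borel) (\<lambda>k \<omega>. w k *\<^sub>R (W (\<tau> (Suc k)) \<omega> - W (\<tau> k) \<omega>)) {..<K}"
    by (rule indep_vars_compose2) simp
next
  fix k assume k: "k \<in> {..<K}"
  then have "multivariate_normal M (\<lambda>\<omega>. W (\<tau> (Suc k)) \<omega> - W (\<tau> k) \<omega>) 0 ((\<tau> (Suc k) - \<tau> k) *\<^sub>R mat 1)"
    using W \<tau> unfolding standard_brownian_motion_on_def by simp
  then show "gaussian M ((w k)\<^sup>2 * (\<tau> (Suc k) - \<tau> k)) (\<lambda>\<omega>. w k *\<^sub>R (W (\<tau> (Suc k)) \<omega> - W (\<tau> k) \<omega>))"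
    using \<tau>(2)[of k] w[of k] k by (intro gaussian_scaleR) (auto simp: multivariate_normal_iff_gaussian)
  show "0 \<le> (w k)\<^sup>2 * (\<tau> (Suc k) - \<tau> k)"
    using \<tau>(2)[of k] k by simp
qed simp

text \<open>Exchanging the two summations exhibits the Riemann sums of the averaged noise as averages, over the
  particles, of independent Gaussian variables.\<close>

lemma mean_noise_weighted_sum:
  "(\<Sum>k<K. w k *\<^sub>R (mean_noise W m (\<tau> (Suc k)) \<omega> - mean_noise W m (\<tau> k) \<omega>))
    = (\<Sum>i = 1..2 ^ m. (1 / 2 ^ m) *\<^sub>R (\<Sum>k<K. w k *\<^sub>R (W m i (\<tau> (Suc k)) \<omega> - W m i (\<tau> k) \<omega>)))"
proof -
  have "mean_noise W m (\<tau> (Suc k)) \<omega> - mean_noise W m (\<tau> k) \<omega>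
      = (\<Sum>i = 1..2 ^ m. (1 / 2 ^ m) *\<^sub>R (W m i (\<tau> (Suc k)) \<omega> - W m i (\<tau> k) \<omega>))" for k
    unfolding mean_noise_def scaleR_diff_right[symmetric] sum_subtractf[symmetric] scaleR_sum_right[symmetric]
    by simp
  then show ?thesis
    by (simp add: scaleR_sum_right mult.commute) (rule sum.swap)
qed

text \<open>Averaging over \<open>2 ^ m\<close> independent particles divides the variance by \<open>2 ^ m\<close>; this factor turns the
  limiting variance into a geometric series with ratio \<open>exp (2 * b) / 2\<close>.\<close>

lemma (in interacting_branching_diffusion) mean_noise_weighted_sum_gaussian:
  assumes \<tau>: "\<And>k. k \<le> K \<Longrightarrow> \<tau> k \<in> {real m..<real m + 1}" "\<And>k. k < K \<Longrightarrow> \<tau> k < \<tau> (Suc k)"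
    and w: "\<And>k. k < K \<Longrightarrow> 0 \<le> w k"
  shows "gaussian M ((\<Sum>k<K. (w k)\<^sup>2 * (\<tau> (Suc k) - \<tau> k)) / 2 ^ m)
    (\<lambda>\<omega>. \<Sum>k<K. w k *\<^sub>R (mean_noise W m (\<tau> (Suc k)) \<omega> - mean_noise W m (\<tau> k) \<omega>))"
proof -
  let ?v = "\<Sum>k<K. (w k)\<^sup>2 * (\<tau> (Suc k) - \<tau> k)"
  let ?X = "\<lambda>i \<omega>. (1 / 2 ^ m) *\<^sub>R (\<Sum>k<K. w k *\<^sub>R (W m i (\<tau> (Suc k)) \<omega> - W m i (\<tau> k) \<omega>))"
  let ?C = "\<lambda>i. cylinder_events M (W m i) {real m..<real m + 1}"
  have v: "0 \<le> ?v" using \<tau>(2) by (intro sum_nonneg mult_nonneg_nonneg) (auto simp: less_imp_le)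
  have "gaussian M (\<Sum>i\<in>{1..2 ^ m :: nat}. (1 / 2 ^ m)\<^sup>2 * ?v) (\<lambda>\<omega>. \<Sum>i = 1..2 ^ m. ?X i \<omega>)"
  proof (rule gaussian_sum)
    show "indep_vars (\<lambda>_. borel) ?X {1..2 ^ m}"
    proof (rule indep_vars_from_indep_sigma)
      show "indep_sets (\<lambda>i. sigma_sets (space M) (?C i)) {1..2 ^ m}"
        using brownian_indep[of m] by (simp add: generated_events_def)
      show "?C i \<subseteq> Pow (space M)" for i by (rule cylinder_events_subset_Pow)
      show "?X i \<in> borel_measurable (sigma (space M) (?C i))" for i
      proof -
        have [measurable]: "W m i (\<tau> k) \<in> borel_measurable (sigma (space M) (?C i))" if "k \<le> K" for k
          using \<tau>(1)[OF that] by (rule measurable_cylinder_sigma) (simp_all add: cylinder_events_subset_Pow)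
        show ?thesis
          by (intro borel_measurable_scaleR borel_measurable_sum borel_measurable_diff borel_measurable_const) auto
      qed
    qed
    show "gaussian M ((1 / 2 ^ m)\<^sup>2 * ?v) (?X i)" if "i \<in> {1..2 ^ m}" for i
      using brownian_weighted_sum_gaussian[where \<tau>=\<tau> and K=K and w=w, OF brownian[OF that] \<tau> w]
      by (intro gaussian_scaleR) auto
    show "0 \<le> (1 / 2 ^ m)\<^sup>2 * ?v" using v by simp
  qed simp
  then show ?thesis
    by (simp add: mean_noise_weighted_sum power2_eq_square)
qed

text \<open>Independence is stated for the Riemann sums rather than for their limits: they are exactly, not
  only almost surely, measurable with respect to the driving Brownian motions.\<close>

lemma (in interacting_branching_diffusion) indep_past_mean_noise:
  assumes \<tau>: "\<And>k. k \<le> K \<Longrightarrow> \<tau> k \<in> {real m..<real m + 1}"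
  shows "indep_var borel (\<lambda>\<omega>. \<Sum>k<K. w k *\<^sub>R (mean_noise W m (\<tau> (Suc k)) \<omega> - mean_noise W m (\<tau> k) \<omega>))
    borel (\<lambda>\<omega>. c *\<^sub>R center_of_mass Z (real m) \<omega>)"
proof -
  define J where "J = {1..2 ^ m :: nat} \<times> {real m..<real m + 1}"
  define \<C> where "\<C> = cylinder_events M (\<lambda>(i, t). W m i t) J"
  define I where "I = (SIGMA t:{0..real m}. {1..num_particles t})"
  define \<P> where "\<P> = cylinder_events M (\<lambda>(t, i). Z t i) I \<union>
      cylinder_events M (\<lambda>(k, i, t). W k i t) (SIGMA k:{..<m}. {1..2 ^ k} \<times> {real k..<real k + 1}) \<union>
      cylinder_events M (\<lambda>(k, i). p k i) (SIGMA k:{..<m}. {1..2 ^ Suc k})"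
  have Pow: "\<C> \<subseteq> Pow (space M)" "\<P> \<subseteq> Pow (space M)"
    by (auto simp: \<C>_def \<P>_def cylinder_events_def)
  show ?thesis
  proof (rule indep_var_from_indep_sigma)
    show "indep_set (sigma_sets (space M) \<C>) (sigma_sets (space M) \<P>)"
      using brownian_indep_past[of m]
      by (simp only: generated_events_def past_events_def \<C>_def J_def \<P>_def I_def)
    show "\<C> \<subseteq> Pow (space M)" "\<P> \<subseteq> Pow (space M)" by fact+
    have W: "W m i (\<tau> k) \<in> borel_measurable (sigma (space M) \<C>)" if "i \<in> {1..2 ^ m}" "k \<le> K" for i k
      using measurable_cylinder_sigma[of "(i, \<tau> k)" J \<C> M "\<lambda>(i, t). W m i t"] that \<tau>[OF that(2)] Pow
      by (simp add: J_def \<C>_def)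
    show "(\<lambda>\<omega>. \<Sum>k<K. w k *\<^sub>R (mean_noise W m (\<tau> (Suc k)) \<omega> - mean_noise W m (\<tau> k) \<omega>))
        \<in> borel_measurable (sigma (space M) \<C>)"
      unfolding mean_noise_weighted_sum
      by (intro borel_measurable_scaleR borel_measurable_sum borel_measurable_diff borel_measurable_const W) auto
    have Z: "Z (real m) i \<in> borel_measurable (sigma (space M) \<P>)" if "i \<in> {1..2 ^ m}" for i
    proof -
      have "num_particles (real m) = 2 ^ m" by (rule num_particles_eq) simp
      then have "(real m, i) \<in> I" using that by (simp add: I_def)
      moreover have "cylinder_events M (\<lambda>(t, i). Z t i) I \<subseteq> \<P>" by (auto simp: \<P>_def)
      ultimately show ?thesis
        using measurable_cylinder_sigma[of "(real m, i)" I \<P> M "\<lambda>(t, i). Z t i"] Pow(2) by simp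
    qed
    have m: "real m \<in> {real m..<real m + 1}" by simp
    show "(\<lambda>\<omega>. c *\<^sub>R center_of_mass Z (real m) \<omega>) \<in> borel_measurable (sigma (space M) \<P>)"
      unfolding center_of_mass_eq[OF m]
      by (intro borel_measurable_scaleR borel_measurable_sum borel_measurable_const Z) auto
  qed
qed

text \<open>The Riemann sums are geometric sums with ratio \<open>exp (\<beta> h)\<close>, and \<open>(exp (\<beta> h) - 1) / h\<close> tends to
  \<open>\<beta>\<close> as the mesh \<open>h\<close> tends to \<open>0\<close>.\<close>

lemma exp_riemann_sums_converge:
  fixes a d \<beta> :: real
  assumes d: "0 < d" and \<beta>: "\<beta> \<noteq> 0"
  shows "(\<lambda>K. \<Sum>k<Suc K. exp (\<beta> * (a + real k * (d / real (Suc K)))) * (d / real (Suc K)))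
    \<longlonglongrightarrow> (exp (\<beta> * (a + d)) - exp (\<beta> * a)) / \<beta>"
proof -
  define h where "h K = d / real (Suc K)" for K
  have h: "0 < h K" for K using d by (simp add: h_def)
  have hd: "real (Suc K) * h K = d" for K by (simp add: h_def)
  have "(\<Sum>k<Suc K. exp (\<beta> * (a + real k * h K)) * h K)
      = exp (\<beta> * a) * (exp (\<beta> * d) - 1) * (h K / (exp (\<beta> * h K) - 1))" for K
  proof -
    have ne: "exp (\<beta> * h K) \<noteq> 1" using h[of K] \<beta> by simp
    have "(\<Sum>k<Suc K. exp (\<beta> * (a + real k * h K)) * h K)
        = (\<Sum>k<Suc K. exp (\<beta> * a) * h K * exp (\<beta> * h K) ^ k)"
      by (intro sum.cong refl) (simp add: distrib_left exp_add ac_simps flip: exp_of_nat_mult)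
    also have "\<dots> = exp (\<beta> * a) * h K * ((exp (\<beta> * h K) ^ Suc K - 1) / (exp (\<beta> * h K) - 1))"
      by (simp only: sum_distrib_left[symmetric] geometric_sum[OF ne])
    also have "exp (\<beta> * h K) ^ Suc K = exp (\<beta> * (real (Suc K) * h K))"
      by (simp only: exp_of_nat_mult[symmetric]) (simp add: ac_simps)
    finally show ?thesis by (simp only: hd) simp
  qed
  moreover have "(\<lambda>K. h K / (exp (\<beta> * h K) - 1)) \<longlonglongrightarrow> 1 / \<beta>"
  proof -
    have "((\<lambda>x. exp (\<beta> * x)) has_real_derivative \<beta>) (at 0)"
      by (auto intro!: derivative_eq_intros)
    then have "(\<lambda>x. (exp (\<beta> * x) - 1) / x) \<midarrow>0\<rightarrow> \<beta>"
      by (simp add: has_field_derivative_iff)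
    moreover have "filterlim h (at 0) sequentially"
    proof -
      have "h \<longlonglongrightarrow> 0" unfolding h_def
        using LIMSEQ_Suc[OF lim_const_over_n[of d]] by simp
      then show ?thesis using h by (auto simp: filterlim_at less_imp_neq[symmetric])
    qed
    ultimately have "(\<lambda>K. (exp (\<beta> * h K) - 1) / h K) \<longlonglongrightarrow> \<beta>"
      by (rule filterlim_compose)
    then have "(\<lambda>K. inverse ((exp (\<beta> * h K) - 1) / h K)) \<longlonglongrightarrow> inverse \<beta>"
      using \<beta> by (rule tendsto_inverse)
    then show ?thesis by (simp add: field_simps)
  qed
  then have "(\<lambda>K. exp (\<beta> * a) * (exp (\<beta> * d) - 1) * (h K / (exp (\<beta> * h K) - 1)))
      \<longlonglongrightarrow> exp (\<beta> * a) * (exp (\<beta> * d) - 1) * (1 / \<beta>)"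
    by (rule tendsto_mult_left)
  moreover have "exp (\<beta> * a) * (exp (\<beta> * d) - 1) * (1 / \<beta>) = (exp (\<beta> * (a + d)) - exp (\<beta> * a)) / \<beta>"
    by (simp add: distrib_left exp_add right_diff_distrib)
  ultimately show ?thesis unfolding h_def by (simp only:)
qed

lemma (in interacting_branching_diffusion) center_of_mass_measurable:
  "0 \<le> t \<Longrightarrow> center_of_mass Z t \<in> borel_measurable M"
  unfolding center_of_mass_def[abs_def]
  by (intro borel_measurable_scaleR borel_measurable_sum borel_measurable_const Z_measurable) auto

text \<open>At time \<open>t\<close> the weighted center of mass is the almost sure limit of its value at time \<open>m\<close> plus
  Riemann sums of the new noise. For every fixed mesh this is a sum of two independent Gaussian
  variables, and Gaussian laws pass to the limit together with their variances.\<close>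

lemma (in interacting_branching_diffusion) weighted_center_gaussian_within_generation:
  assumes b: "b < 0" and v: "0 \<le> v"
    and past: "gaussian M v (\<lambda>\<omega>. exp (b * real m) *\<^sub>R center_of_mass Z (real m) \<omega>)"
    and t: "real m < t" "t < real m + 1"
  shows "gaussian M (v + (exp (2 * b * t) - exp (2 * b * real m)) / (2 * b) / 2 ^ m)
    (\<lambda>\<omega>. exp (b * t) *\<^sub>R center_of_mass Z t \<omega>)"
proof -
  define \<tau> where "\<tau> K k = real m + real k * ((t - real m) / real (Suc K))" for K k
  define w where "w K k = exp (b * \<tau> K k)" for K k
  define S where "S K \<omega> = (\<Sum>k<Suc K. w K k *\<^sub>R
      (mean_noise W m (\<tau> K (Suc k)) \<omega> - mean_noise W m (\<tau> K k) \<omega>))" for K \<omega>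
  define u where "u K = (\<Sum>k<Suc K. (w K k)\<^sup>2 * (\<tau> K (Suc k) - \<tau> K k))" for K
  have diff: "\<tau> K (Suc k) - \<tau> K k = (t - real m) / real (Suc K)" for K k
    by (simp add: \<tau>_def distrib_right add_divide_distrib)
  have inc: "\<tau> K k < \<tau> K (Suc k)" for K k
  proof -
    have "0 < (t - real m) / real (Suc K)" using t by simp
    then show ?thesis using diff[of K k] by linarith
  qed
  have range: "\<tau> K k \<in> {real m..<real m + 1}" if "k \<le> Suc K" for K k
  proof -
    have "real k * ((t - real m) / real (Suc K)) \<le> real (Suc K) * ((t - real m) / real (Suc K))"
      using that t by (intro mult_right_mono) auto
    then have "\<tau> K k \<le> t" unfolding \<tau>_def by simp
    moreover have "real m \<le> \<tau> K k" unfolding \<tau>_def using t by simp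
    ultimately show ?thesis using t by simp
  qed
  have u_pos: "0 < u K" for K
    unfolding u_def using inc by (intro sum_pos) (auto simp: w_def)
  have "gaussian M (u K / 2 ^ m) (S K)" for K
    unfolding u_def S_def
    by (rule mean_noise_weighted_sum_gaussian) (use range inc in \<open>auto simp: w_def\<close>)
  moreover have "indep_var borel (S K) borel (\<lambda>\<omega>. exp (b * real m) *\<^sub>R center_of_mass Z (real m) \<omega>)" for K
    unfolding S_def by (rule indep_past_mean_noise) (use range in auto)
  ultimately have X: "gaussian M (u K / 2 ^ m + v)
      (\<lambda>\<omega>. S K \<omega> + exp (b * real m) *\<^sub>R center_of_mass Z (real m) \<omega>)" for K
    using past v u_pos[of K] by (intro gaussian_add) auto
  have "u \<longlonglongrightarrow> (exp (2 * b * (real m + (t - real m))) - exp (2 * b * real m)) / (2 * b)"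
  proof -
    have "u = (\<lambda>K. \<Sum>k<Suc K. exp (2 * b * (real m + real k * ((t - real m) / real (Suc K))))
        * ((t - real m) / real (Suc K)))"
      unfolding u_def diff w_def
      by (intro ext sum.cong refl) (simp add: \<tau>_def exp_double[symmetric] mult.assoc)
    then show ?thesis
      using exp_riemann_sums_converge[of "t - real m" "2 * b" "real m"] t b by simp
  qed
  then have var: "(\<lambda>K. u K / 2 ^ m + v) \<longlonglongrightarrow> v + (exp (2 * b * t) - exp (2 * b * real m)) / (2 * b) / 2 ^ m"
    by (auto intro!: tendsto_eq_intros)
  have "exp (2 * b * t) < exp (2 * b * real m)" using b t by simp
  then have "0 < (exp (2 * b * t) - exp (2 * b * real m)) / (2 * b)"
    using b by (simp add: zero_less_divide_iff)
  then have pos: "0 < v + (exp (2 * b * t) - exp (2 * b * real m)) / (2 * b) / 2 ^ m"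
    using v by (intro add_nonneg_pos divide_pos_pos[of _ "2 ^ m"]) auto
  have conv: "AE \<omega> in M. (\<lambda>K. S K \<omega> + exp (b * real m) *\<^sub>R center_of_mass Z (real m) \<omega>)
      \<longlonglongrightarrow> exp (b * t) *\<^sub>R center_of_mass Z t \<omega>"
    using AE_center_of_mass_continuous[of m] AE_mean_noise_continuous[of m] AE_center_of_mass_motion[of m]
  proof eventually_elim
    case (elim \<omega>)
    have sub: "{real m..t} \<subseteq> {real m..<real m + 1}" using t by auto
    have "(\<lambda>K. S K \<omega>) \<longlonglongrightarrow> exp (b * t) *\<^sub>R center_of_mass Z t \<omega>
        - exp (b * real m) *\<^sub>R center_of_mass Z (real m) \<omega>"
      unfolding S_def w_def \<tau>_def
    proof (rule weighted_riemann_sums_converge)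
      show "continuous_on {real m..t} (\<lambda>t. center_of_mass Z t \<omega>)"
        by (rule continuous_on_subset[OF elim(1) sub])
      show "continuous_on {real m..t} (\<lambda>t. mean_noise W m t \<omega>)"
        by (rule continuous_on_subset[OF elim(2) sub])
      show "center_of_mass Z r \<omega> = center_of_mass Z (real m) \<omega>
          + (mean_noise W m r \<omega> - mean_noise W m (real m) \<omega>)
          - b *\<^sub>R integral {real m..r} (\<lambda>t. center_of_mass Z t \<omega>)" if "r \<in> {real m..t}" for r
        unfolding mean_noise_start diff_zero by (rule bspec[OF elim(3)]) (use that sub in blast)
    qed (use t b in auto)
    from tendsto_add[OF this tendsto_const[of "exp (b * real m) *\<^sub>R center_of_mass Z (real m) \<omega>"]]
    show ?case by simp
  qed
  show ?thesis
  proof (rule gaussian_limit[OF X _ var pos _ conv])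
    show "0 < u K / 2 ^ m + v" for K using u_pos[of K] v by (simp add: add_pos_nonneg)
    show "(\<lambda>\<omega>. exp (b * t) *\<^sub>R center_of_mass Z t \<omega>) \<in> borel_measurable M"
      using t by (intro borel_measurable_scaleR borel_measurable_const center_of_mass_measurable) simp
  qed
qed

text \<open>The driving Brownian motions do not reach the branching time \<open>m + 1\<close>, so that time is approached
  from the left; the center of mass is continuous there.\<close>

lemma (in interacting_branching_diffusion) weighted_center_gaussian_step:
  assumes b: "b < 0" and v: "0 \<le> v"
    and past: "gaussian M v (\<lambda>\<omega>. exp (b * real m) *\<^sub>R center_of_mass Z (real m) \<omega>)"
  shows "gaussian M (v + (exp (2 * b * real (Suc m)) - exp (2 * b * real m)) / (2 * b) / 2 ^ m)
    (\<lambda>\<omega>. exp (b * real (Suc m)) *\<^sub>R center_of_mass Z (real (Suc m)) \<omega>)"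
proof -
  \<comment> \<open>Shifting the index by two keeps \<open>t 0\<close> strictly above \<open>m\<close>.\<close>
  define t where "t n = real (Suc m) - inverse (real (Suc (Suc n)))" for n
  have t: "real m < t n" "t n < real m + 1" for n by (auto simp: t_def field_simps)
  have tlim: "t \<longlonglongrightarrow> real (Suc m)" unfolding t_def
    using tendsto_diff[OF tendsto_const LIMSEQ_Suc[OF LIMSEQ_inverse_real_of_nat]] by simp
  have tleft: "filterlim t (at_left (real (Suc m))) sequentially"
    using tlim t by (auto simp: filterlim_at less_imp_neq add.commute intro!: always_eventually)
  let ?V = "\<lambda>t. v + (exp (2 * b * t) - exp (2 * b * real m)) / (2 * b) / 2 ^ m"
  have V_pos: "0 < ?V t" if "real m < t" for t
  proof -
    have "exp (2 * b * t) < exp (2 * b * real m)" using b that by simp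
    then have "0 < (exp (2 * b * t) - exp (2 * b * real m)) / (2 * b)"
      using b by (simp add: zero_less_divide_iff)
    then show ?thesis using v by (intro add_nonneg_pos divide_pos_pos[of _ "2 ^ m"]) auto
  qed
  show ?thesis
  proof (rule gaussian_limit)
    show "gaussian M (?V (t n)) (\<lambda>\<omega>. exp (b * t n) *\<^sub>R center_of_mass Z (t n) \<omega>)" for n
      by (rule weighted_center_gaussian_within_generation[OF b v past t])
    show "0 < ?V (t n)" for n by (rule V_pos[OF t(1)])
    show "(\<lambda>n. ?V (t n)) \<longlonglongrightarrow> ?V (real (Suc m))"
      using b by (intro tendsto_intros tlim) auto
    show "0 < ?V (real (Suc m))" by (rule V_pos) simp
    show "(\<lambda>\<omega>. exp (b * real (Suc m)) *\<^sub>R center_of_mass Z (real (Suc m)) \<omega>) \<in> borel_measurable M"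
      by (intro borel_measurable_scaleR borel_measurable_const center_of_mass_measurable) simp
    show "AE \<omega> in M. (\<lambda>n. exp (b * t n) *\<^sub>R center_of_mass Z (t n) \<omega>)
        \<longlonglongrightarrow> exp (b * real (Suc m)) *\<^sub>R center_of_mass Z (real (Suc m)) \<omega>"
      using AE_center_of_mass_left_limit[of m]
    proof eventually_elim
      case (elim \<omega>)
      then have "(\<lambda>n. center_of_mass Z (t n) \<omega>) \<longlonglongrightarrow> center_of_mass Z (real (Suc m)) \<omega>"
        using tleft by (rule filterlim_compose)
      then show ?case by (intro tendsto_intros tlim)
    qed
  qed
qed

text \<open>The variance of the weighted center of mass at time \<open>m\<close>: generation \<open>j\<close> contributes
  \<open>2 ^ (- j)\<close> times the integral of \<open>exp (2 * b * r)\<close> over \<open>[j, j + 1]\<close>.\<close>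

definition center_variance :: "real \<Rightarrow> nat \<Rightarrow> real" where
  "center_variance b m = (1 - exp (2 * b)) / (2 * \<bar>b\<bar>) * (\<Sum>j<m. (exp (2 * b) / 2) ^ j)"

lemma (in interacting_branching_diffusion) weighted_center_gaussian:
  assumes b: "b < 0"
  shows "gaussian M (center_variance b m) (\<lambda>\<omega>. exp (b * real m) *\<^sub>R center_of_mass Z (real m) \<omega>)"
proof (induction m)
  case 0
  have "AE \<omega> in M. exp (b * real 0) *\<^sub>R center_of_mass Z (real 0) \<omega> = 0"
    using initial by eventually_elim (simp add: center_of_mass_def num_particles_def)
  moreover have "(\<lambda>\<omega>. exp (b * real 0) *\<^sub>R center_of_mass Z (real 0) \<omega>) \<in> borel_measurable M"
    by (intro borel_measurable_scaleR borel_measurable_const center_of_mass_measurable) simp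
  ultimately show ?case
    using gaussian_0_iff[of "\<lambda>\<omega>. exp (b * real 0) *\<^sub>R center_of_mass Z (real 0) \<omega>"]
    by (simp add: center_variance_def)
next
  case (Suc m)
  have "exp (2 * b) \<le> 1" using b by simp
  then have v: "0 \<le> center_variance b m"
    unfolding center_variance_def
    by (intro mult_nonneg_nonneg divide_nonneg_nonneg sum_nonneg) auto
  have "(exp (2 * b * real (Suc m)) - exp (2 * b * real m)) / (2 * b) / 2 ^ m
      = (1 - exp (2 * b)) / (2 * \<bar>b\<bar>) * (exp (2 * b) / 2) ^ m"
  proof -
    have "exp (2 * b * real m) = exp (2 * b) ^ m"
      by (simp add: exp_of_nat_mult[symmetric] ac_simps)
    moreover have "exp (2 * b * real (Suc m)) = exp (2 * b) * exp (2 * b * real m)"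
      by (simp add: distrib_left flip: exp_add)
    ultimately show ?thesis using b by (simp add: power_divide field_simps)
  qed
  with weighted_center_gaussian_step[OF b v Suc] show ?case
    by (simp only: center_variance_def sum.lessThan_Suc distrib_left)
qed

lemma center_variance_limit:
  assumes b: "b < 0"
  shows "center_variance b \<longlonglongrightarrow> (1 - exp (2 * b)) / (\<bar>b\<bar> * (2 - exp (2 * b)))"
proof -
  have e: "exp (2 * b) < 1" using b by simp
  then have e2: "exp (2 * b) < 2" by linarith
  then have "(\<lambda>j. (exp (2 * b) / 2) ^ j) sums (1 / (1 - exp (2 * b) / 2))"
    by (intro geometric_sums) simp
  then have "center_variance b \<longlonglongrightarrow> (1 - exp (2 * b)) / (2 * \<bar>b\<bar>) * (1 / (1 - exp (2 * b) / 2))"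
    unfolding center_variance_def[abs_def] sums_def by (rule tendsto_mult_left)
  also have "(1 - exp (2 * b)) / (2 * \<bar>b\<bar>) * (1 / (1 - exp (2 * b) / 2))
      = (1 - exp (2 * b)) / (\<bar>b\<bar> * (2 - exp (2 * b)))"
    using e2 b by (simp add: divide_simps) (simp add: algebra_simps)
  finally show ?thesis .
qed

section \<open>Almost sure convergence\<close>

text \<open>The gain of \<open>2 ^ (- m)\<close> from averaging is given away: a bound uniform in \<open>m\<close> suffices, since the
  weight \<open>exp (b * m)\<close> already decays.\<close>

lemma (in interacting_branching_diffusion) mean_noise_increment_moment:
  assumes s: "real m \<le> s" "s < t" "t < real m + 1"
  shows "(\<integral>\<^sup>+\<omega>. ennreal (norm (mean_noise W m t \<omega> - mean_noise W m s \<omega>) ^ 4) \<partial>M)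
    \<le> ennreal (3 * real CARD('n) ^ 2 * (t - s)\<^sup>2)"
proof -
  \<comment> \<open>The increment is a weighted sum over the one-cell grid with endpoints \<open>s\<close> and \<open>t\<close>.\<close>
  have "gaussian M ((\<Sum>k<1. 1\<^sup>2 * ((if Suc k = 0 then s else t) - (if k = 0 then s else t))) / 2 ^ m)
      (\<lambda>\<omega>. \<Sum>k<1. 1 *\<^sub>R (mean_noise W m (if Suc k = 0 then s else t) \<omega>
        - mean_noise W m (if k = 0 then s else t) \<omega>))"
    by (rule mean_noise_weighted_sum_gaussian[where \<tau>="\<lambda>k. if k = 0 then s else t"]) (use s in auto)
  then have "gaussian M ((t - s) / 2 ^ m) (\<lambda>\<omega>. mean_noise W m t \<omega> - mean_noise W m s \<omega>)"
    by simp
  then have "(\<integral>\<^sup>+\<omega>. ennreal (norm (mean_noise W m t \<omega> - mean_noise W m s \<omega>) ^ 4) \<partial>M)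
      \<le> ennreal (3 * real DIM(real ^ 'n) ^ 2 * ((t - s) / 2 ^ m)\<^sup>2)"
    using s by (intro nn_integral_gaussian_norm_pow4) auto
  also have "\<dots> \<le> ennreal (3 * real CARD('n) ^ 2 * (t - s)\<^sup>2)"
  proof -
    have "(t - s) / 2 ^ m \<le> (t - s) / 1"
      using s by (intro divide_left_mono) auto
    then have "((t - s) / 2 ^ m)\<^sup>2 \<le> (t - s)\<^sup>2"
      using s by (intro power_mono) auto
    then show ?thesis
      by (intro ennreal_leI) (simp add: mult_left_mono)
  qed
  finally show ?thesis .
qed

lemma (in interacting_branching_diffusion) mean_noise_measurable:
  "t \<in> {real m..<real m + 1} \<Longrightarrow> mean_noise W m t \<in> borel_measurable M"
  using brownian unfolding mean_noise_def[abs_def] standard_brownian_motion_on_def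
  by (intro borel_measurable_scaleR borel_measurable_sum borel_measurable_diff borel_measurable_const) auto

lemma dyadic_in_unit_interval:
  "k + 1 < 2 ^ n \<Longrightarrow> a \<le> a + real k / 2 ^ n \<and> a + real k / 2 ^ n < a + real (k + 1) / 2 ^ n
    \<and> a + real (k + 1) / 2 ^ n < a + 1"
proof -
  assume "k + 1 < 2 ^ n"
  then have "real (k + 1) < 2 ^ n" by (simp only: of_nat_less_numeral_power_cancel_iff)
  then show ?thesis by (simp add: divide_strict_right_mono)
qed

text \<open>All dyadic increments in all generations are controlled at once by the finiteness almost surely of a
  single random series: the fourth powers of the increments with weights \<open>exp (2 * b * m) * w ^ n\<close>.
  Level \<open>n\<close> has fewer than \<open>2 ^ n\<close> increments of fourth moment of order \<open>4 ^ (- n)\<close>, so the series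
  has finite mean as soon as \<open>w < 2\<close>. Each summand is at most the sum \<open>K\<close> of the series; taking
  fourth roots gives a geometric decay in \<open>n\<close> if \<open>w > 1\<close>, at the price of a growth
  \<open>exp (- b * m / 2)\<close> in \<open>m\<close>.\<close>

lemma (in interacting_branching_diffusion) AE_dyadic_increment_bound:
  assumes b: "b < 0"
  shows "AE \<omega> in M. \<exists>L\<ge>0. \<forall>m n k. k + 1 < 2 ^ n \<longrightarrow>
    norm (mean_noise W m (real m + real (k + 1) / 2 ^ n) \<omega> - mean_noise W m (real m + real k / 2 ^ n) \<omega>)
      \<le> L * exp (- b * real m / 2) * (9 / 10) ^ n"
proof -
  define \<Delta> where "\<Delta> m n k \<omega> = norm (mean_noise W m (real m + real (k + 1) / 2 ^ n) \<omega>
    - mean_noise W m (real m + real k / 2 ^ n) \<omega>)" for m n k \<omega>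
  \<comment> \<open>Any \<open>w\<close> strictly between \<open>1\<close> and \<open>2\<close> works; a fourth power has a rational fourth root.\<close>
  define w :: real where "w = (10 / 9) ^ 4"
  define C where "C = 3 * real CARD('n) ^ 2"
  define Q where "Q m n \<omega> = (\<Sum>k | k + 1 < (2::nat) ^ n. ennreal (exp (2 * b) ^ m * w ^ n * \<Delta> m n k \<omega> ^ 4))" for m n \<omega>
  have w: "0 < w" "w < 2" by (simp_all add: w_def power_divide)
  have C: "0 \<le> C" by (simp add: C_def)
  have fin: "finite {k. k + 1 < (2::nat) ^ n}" for n
    by (rule finite_subset[of _ "{..<2 ^ n}"]) auto
  have \<Delta>_meas [measurable]: "\<Delta> m n k \<in> borel_measurable M" if "k + 1 < 2 ^ n" for m n k
  proof -
    have [measurable]: "mean_noise W m (real m + real (k + 1) / 2 ^ n) \<in> borel_measurable M"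
        "mean_noise W m (real m + real k / 2 ^ n) \<in> borel_measurable M"
      using dyadic_in_unit_interval[OF that, of "real m"]
      by (intro mean_noise_measurable, simp only: atLeastLessThan_iff, intro conjI; linarith)+
    show ?thesis unfolding \<Delta>_def[abs_def] by measurable
  qed
  have Q_meas [measurable]: "Q m n \<in> borel_measurable M" for m n
    unfolding Q_def[abs_def] by (intro borel_measurable_sum) (use \<Delta>_meas in measurable)
  have Q_int: "(\<integral>\<^sup>+\<omega>. Q m n \<omega> \<partial>M) \<le> ennreal (exp (2 * b) ^ m * (C * (w / 2) ^ n))" for m n
  proof -
    have "(\<integral>\<^sup>+\<omega>. Q m n \<omega> \<partial>M)
        = (\<Sum>k | k + 1 < (2::nat) ^ n. \<integral>\<^sup>+\<omega>. ennreal (exp (2 * b) ^ m * w ^ n * \<Delta> m n k \<omega> ^ 4) \<partial>M)"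
      unfolding Q_def by (intro nn_integral_sum) (use \<Delta>_meas in measurable)
    also have "\<dots> \<le> (\<Sum>k | k + 1 < (2::nat) ^ n. ennreal (exp (2 * b) ^ m * w ^ n * (C * (1 / 2 ^ n)\<^sup>2)))"
    proof (rule sum_mono)
      fix k :: nat assume "k \<in> {k. k + 1 < 2 ^ n}"
      then have k: "k + 1 < 2 ^ n" by simp
      have "(\<integral>\<^sup>+\<omega>. ennreal (exp (2 * b) ^ m * w ^ n * \<Delta> m n k \<omega> ^ 4) \<partial>M)
          = (\<integral>\<^sup>+\<omega>. ennreal (exp (2 * b) ^ m * w ^ n) * ennreal (\<Delta> m n k \<omega> ^ 4) \<partial>M)"
        using w by (intro nn_integral_cong ennreal_mult) (auto simp: \<Delta>_def)
      also have "\<dots> = ennreal (exp (2 * b) ^ m * w ^ n) * (\<integral>\<^sup>+\<omega>. ennreal (\<Delta> m n k \<omega> ^ 4) \<partial>M)"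
        using k by (intro nn_integral_cmult) simp
      also have "(\<integral>\<^sup>+\<omega>. ennreal (\<Delta> m n k \<omega> ^ 4) \<partial>M) \<le> ennreal (C * (1 / 2 ^ n)\<^sup>2)"
      proof -
        have e: "(real m + real (k + 1) / 2 ^ n) - (real m + real k / 2 ^ n) = 1 / 2 ^ n"
          by (simp add: add_divide_distrib)
        show ?thesis
          using mean_noise_increment_moment[of m "real m + real k / 2 ^ n" "real m + real (k + 1) / 2 ^ n"]
            dyadic_in_unit_interval[OF k, of "real m"]
          unfolding e \<Delta>_def C_def by blast
      qed
      also have "ennreal (exp (2 * b) ^ m * w ^ n) * ennreal (C * (1 / 2 ^ n)\<^sup>2)
          = ennreal (exp (2 * b) ^ m * w ^ n * (C * (1 / 2 ^ n)\<^sup>2))"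
        using w C by (intro ennreal_mult[symmetric]) auto
      finally show "(\<integral>\<^sup>+\<omega>. ennreal (exp (2 * b) ^ m * w ^ n * \<Delta> m n k \<omega> ^ 4) \<partial>M)
          \<le> ennreal (exp (2 * b) ^ m * w ^ n * (C * (1 / 2 ^ n)\<^sup>2))"
        by (simp add: mult_left_mono)
    qed
    also have "\<dots> \<le> (\<Sum>k<(2::nat) ^ n. ennreal (exp (2 * b) ^ m * w ^ n * (C * (1 / 2 ^ n)\<^sup>2)))"
      by (intro sum_mono2) auto
    also have "\<dots> = ennreal (\<Sum>k<(2::nat) ^ n. exp (2 * b) ^ m * w ^ n * (C * (1 / 2 ^ n)\<^sup>2))"
      using w C by (intro sum_ennreal) auto
    also have "(\<Sum>k<(2::nat) ^ n. exp (2 * b) ^ m * w ^ n * (C * (1 / 2 ^ n)\<^sup>2))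
        = exp (2 * b) ^ m * (C * (w / 2) ^ n)"
      by (simp add: power_divide power2_eq_square field_simps)
    finally show ?thesis .
  qed
  have "(\<integral>\<^sup>+\<omega>. (\<Sum>m. \<Sum>n. Q m n \<omega>) \<partial>M) = (\<Sum>m. \<Sum>n. \<integral>\<^sup>+\<omega>. Q m n \<omega> \<partial>M)"
    by (simp add: nn_integral_suminf)
  also have "\<dots> \<le> (\<Sum>m. \<Sum>n. ennreal (exp (2 * b) ^ m * (C * (w / 2) ^ n)))"
    by (intro suminf_le Q_int) auto
  also have "\<dots> = (\<Sum>m. ennreal (exp (2 * b) ^ m * (C * (1 / (1 - w / 2)))))"
  proof (intro suminf_cong suminf_ennreal_eq)
    show "(\<lambda>n. exp (2 * b) ^ m * (C * (w / 2) ^ n)) sums (exp (2 * b) ^ m * (C * (1 / (1 - w / 2))))" for m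
      using w by (intro sums_mult geometric_sums) simp
  qed (use w C in auto)
  also have "\<dots> = ennreal (1 / (1 - exp (2 * b)) * (C * (1 / (1 - w / 2))))"
  proof (rule suminf_ennreal_eq)
    show "(\<lambda>m. exp (2 * b) ^ m * (C * (1 / (1 - w / 2)))) sums
        (1 / (1 - exp (2 * b)) * (C * (1 / (1 - w / 2))))"
      using b by (intro sums_mult2 geometric_sums) simp
  qed (use w C in auto)
  also have "\<dots> < \<infinity>" by simp
  finally have "AE \<omega> in M. (\<Sum>m. \<Sum>n. Q m n \<omega>) \<noteq> \<infinity>"
    by (intro nn_integral_PInf_AE) auto
  then show ?thesis
  proof eventually_elim
    case (elim \<omega>)
    then obtain K where K: "0 \<le> K" "(\<Sum>m. \<Sum>n. Q m n \<omega>) = ennreal K"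
      by (cases "\<Sum>m. \<Sum>n. Q m n \<omega>") auto
    define L where "L = root 4 K"
    have L: "0 \<le> L" "L ^ 4 = K" using K(1) by (simp_all add: L_def)
    have "\<Delta> m n k \<omega> \<le> L * exp (- b * real m / 2) * (9 / 10) ^ n" if k: "k + 1 < 2 ^ n" for m n k
    proof -
      have "ennreal (exp (2 * b) ^ m * w ^ n * \<Delta> m n k \<omega> ^ 4) \<le> Q m n \<omega>"
        unfolding Q_def using fin k by (intro member_le_sum) auto
      also have "\<dots> \<le> (\<Sum>n. Q m n \<omega>)"
        using sum_le_suminf[OF summableI, of "{n}" "\<lambda>n. Q m n \<omega>"] by simp
      also have "\<dots> \<le> (\<Sum>m. \<Sum>n. Q m n \<omega>)"
        using sum_le_suminf[OF summableI, of "{m}" "\<lambda>m. \<Sum>n. Q m n \<omega>"] by simp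
      finally have le: "exp (2 * b) ^ m * w ^ n * \<Delta> m n k \<omega> ^ 4 \<le> K"
        using K by (simp add: ennreal_le_iff)
      \<comment> \<open>\<open>E\<close> and \<open>R\<close> are the inverse fourth roots of the weights of \<open>m\<close> and of \<open>n\<close>.\<close>
      define E where "E = exp (- b * real m / 2)"
      define R :: real where "R = (9 / 10) ^ n"
      define c where "c = exp (2 * b) ^ m * w ^ n"
      have E: "exp (2 * b) ^ m * E ^ 4 = 1"
        by (simp add: E_def flip: exp_of_nat_mult exp_add)
      have R: "w ^ n * R ^ 4 = 1"
      proof -
        have "R ^ 4 = ((9 / 10) ^ 4) ^ n"
          by (simp only: R_def power_mult[symmetric] mult.commute)
        then have "w ^ n * R ^ 4 = (w * (9 / 10) ^ 4) ^ n"
          by (simp only: power_mult_distrib)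
        also have "w * (9 / 10) ^ 4 = 1" by (simp add: w_def power_divide)
        finally show ?thesis by simp
      qed
      have c: "0 < c" using w by (simp add: c_def)
      have "c * (L * E * R) ^ 4 = (exp (2 * b) ^ m * E ^ 4) * (w ^ n * R ^ 4) * L ^ 4"
        by (simp only: c_def power_mult_distrib mult_ac)
      also have "\<dots> = K" by (simp only: E R L(2) mult_1)
      finally have "c * \<Delta> m n k \<omega> ^ 4 \<le> c * (L * E * R) ^ 4"
        using le by (simp only: c_def)
      then have "\<Delta> m n k \<omega> ^ 4 \<le> (L * E * R) ^ 4"
        using c by (simp only: mult_le_cancel_left_pos)
      moreover have "0 \<le> \<Delta> m n k \<omega>" "0 \<le> L * E * R"
        using L by (simp_all add: \<Delta>_def E_def R_def)
      ultimately have "\<Delta> m n k \<omega> \<le> L * E * R"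
        by (subst (asm) power_mono_iff) auto
      then show ?thesis by (simp only: E_def R_def)
    qed
    then show ?case unfolding \<Delta>_def using L(1) by blast
  qed
qed

text \<open>Chaining bounds the noise of generation \<open>m\<close> by a multiple of \<open>exp (- b * m / 2)\<close>. The weight
  \<open>exp (b * m)\<close> overcompensates this, and \<open>exp (b * m / 2)\<close> is left.\<close>

lemma (in interacting_branching_diffusion) AE_weighted_center_oscillation:
  assumes b: "b < 0"
  shows "AE \<omega> in M. \<exists>L. \<forall>m. \<forall>t\<in>{real m..<real m + 1}.
    norm (exp (b * t) *\<^sub>R center_of_mass Z t \<omega> - exp (b * real m) *\<^sub>R center_of_mass Z (real m) \<omega>)
      \<le> L * exp (b / 2) ^ m"
proof -
  have "AE \<omega> in M. \<forall>m. continuous_on {real m..<real m + 1} (\<lambda>t. center_of_mass Z t \<omega>)"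
    by (simp add: AE_all_countable AE_center_of_mass_continuous)
  moreover have "AE \<omega> in M. \<forall>m. continuous_on {real m..<real m + 1} (\<lambda>t. mean_noise W m t \<omega>)"
    by (simp add: AE_all_countable AE_mean_noise_continuous)
  moreover have "AE \<omega> in M. \<forall>m. \<forall>t\<in>{real m..<real m + 1}. center_of_mass Z t \<omega>
     = center_of_mass Z (real m) \<omega> + mean_noise W m t \<omega>
       - b *\<^sub>R integral {real m..t} (\<lambda>s. center_of_mass Z s \<omega>)"
    unfolding AE_all_countable using AE_center_of_mass_motion by blast
  ultimately show ?thesis
    using AE_dyadic_increment_bound[OF b]
  proof eventually_elim
    case (elim \<omega>)
    then obtain L where L: "0 \<le> L" and inc: "\<And>m n k. k + 1 < 2 ^ n \<Longrightarrow>
        norm (mean_noise W m (real m + real (k + 1) / 2 ^ n) \<omega> - mean_noise W m (real m + real k / 2 ^ n) \<omega>)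
          \<le> L * exp (- b * real m / 2) * (9 / 10) ^ n"
      by blast
    have "norm (exp (b * t) *\<^sub>R center_of_mass Z t \<omega> - exp (b * real m) *\<^sub>R center_of_mass Z (real m) \<omega>)
        \<le> (1 + 2 * \<bar>b\<bar>) * (10 * L) * exp (b / 2) ^ m"
      if t: "t \<in> {real m..<real m + 1}" for m t
    proof -
      \<comment> \<open>The factor \<open>10\<close> is the sum of the geometric series with ratio \<open>9 / 10\<close>.\<close>
      define \<rho> where "\<rho> = 10 * L * exp (- b * real m / 2)"
      have \<rho>0: "0 \<le> \<rho>" using L by (simp add: \<rho>_def)
      have noise: "norm (mean_noise W m r \<omega>) \<le> \<rho>" if r: "r \<in> {real m..<real m + 1}" for r
      proof -
        have sums: "(\<lambda>n. L * exp (- b * real m / 2) * (9 / 10) ^ n) sums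
            (L * exp (- b * real m / 2) * (1 / (1 - 9 / 10)))"
          by (intro sums_mult geometric_sums) simp
        have "norm (mean_noise W m r \<omega> - mean_noise W m (real m) \<omega>)
            \<le> (\<Sum>n. L * exp (- b * real m / 2) * (9 / 10) ^ n)"
          using elim(2) L sums_summable[OF sums] r
          by (intro chaining_bound inc) auto
        also have "\<dots> = \<rho>"
          using sums_unique[OF sums] by (simp add: \<rho>_def)
        finally show ?thesis by (simp add: mean_noise_def)
      qed
      let ?Y = "\<lambda>t. exp (b * t) *\<^sub>R center_of_mass Z t \<omega>"
      let ?D = "exp (b * real m) *\<^sub>R (mean_noise W m t \<omega> - mean_noise W m (real m) \<omega>)"
      have sub: "{real m..t} \<subseteq> {real m..<real m + 1}" using t by auto
      have "norm (?Y t - ?Y (real m) - ?D) \<le> \<bar>b\<bar> * exp (b * real m) * (2 * \<rho>) * (t - real m)"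
      proof (rule weighted_increment_bound)
        show "continuous_on {real m..t} (\<lambda>t. center_of_mass Z t \<omega>)"
          using elim(1) sub by (blast intro: continuous_on_subset)
        show "center_of_mass Z r \<omega> = center_of_mass Z (real m) \<omega>
            + (mean_noise W m r \<omega> - mean_noise W m (real m) \<omega>)
            - b *\<^sub>R integral {real m..r} (\<lambda>t. center_of_mass Z t \<omega>)" if "r \<in> {real m..t}" for r
          unfolding mean_noise_start diff_zero by (rule bspec[OF elim(3)[THEN spec]]) (use that sub in blast)
        show "norm (mean_noise W m t \<omega> - mean_noise W m r \<omega>) \<le> 2 * \<rho>" if "r \<in> {real m..t}" for r
          using norm_triangle_ineq4[of "mean_noise W m t \<omega>" "mean_noise W m r \<omega>"]
            noise[OF t] noise[of r] that sub by auto
      qed (use t b in auto)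
      also have "\<dots> \<le> \<bar>b\<bar> * exp (b * real m) * (2 * \<rho>)"
        using t \<rho>0 by (intro mult_left_le) auto
      finally have "norm (?Y t - ?Y (real m) - ?D) \<le> \<bar>b\<bar> * exp (b * real m) * (2 * \<rho>)" .
      moreover have "norm ?D \<le> exp (b * real m) * \<rho>"
        using noise[OF t] by (simp add: mean_noise_start mult_left_mono)
      ultimately have "norm (?Y t - ?Y (real m)) \<le> (1 + 2 * \<bar>b\<bar>) * (exp (b * real m) * \<rho>)"
        using norm_triangle_ineq[of "?Y t - ?Y (real m) - ?D" ?D] by (simp add: algebra_simps)
      also have "exp (b * real m) * \<rho> = 10 * L * exp (b / 2) ^ m"
        by (simp add: \<rho>_def exp_of_nat_mult[symmetric] field_simps flip: exp_add)
      finally show ?thesis by (simp add: mult.assoc)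
    qed
    then show ?case by blast
  qed
qed

text \<open>Left limits extend the bound to the increments between integer times, which are then summable; so
  the values at integer times converge, and the oscillation in between tends to \<open>0\<close>.\<close>

lemma piecewise_geometric_oscillation_converges:
  fixes Y :: "real \<Rightarrow> 'a::banach"
  assumes osc: "\<And>m t. t \<in> {real m..<real m + 1} \<Longrightarrow> norm (Y t - Y (real m)) \<le> L * q ^ m"
    and left: "\<And>m. (Y \<longlongrightarrow> Y (real (Suc m))) (at_left (real (Suc m)))"
    and q: "0 \<le> q" "q < 1"
  shows "(Y \<longlongrightarrow> lim (\<lambda>m. Y (real m))) at_top"
proof -
  have step: "norm (Y (real (Suc m)) - Y (real m)) \<le> L * q ^ m" for m
  proof (rule tendsto_upperbound)
    show "((\<lambda>t. norm (Y t - Y (real m))) \<longlongrightarrow> norm (Y (real (Suc m)) - Y (real m))) (at_left (real (Suc m)))"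
      by (intro tendsto_intros left)
    have "\<forall>\<^sub>F t in at_left (real (Suc m)). t \<in> {real m<..<real (Suc m)}"
      by (rule eventually_at_leftI[of "real m"]) auto
    then show "\<forall>\<^sub>F t in at_left (real (Suc m)). norm (Y t - Y (real m)) \<le> L * q ^ m"
      by eventually_elim (rule osc, auto)
  qed simp
  have "summable (\<lambda>m. L * q ^ m)" using q by (intro summable_mult summable_geometric) simp
  then have "summable (\<lambda>m. Y (real (Suc m)) - Y (real m))"
    using step by (rule summable_comparison_test'[where N=0])
  then have "convergent (\<lambda>m. \<Sum>k<m. Y (real (Suc k)) - Y (real k))"
    by (simp add: summable_iff_convergent)
  then have "convergent (\<lambda>m. Y (real m) - Y (real 0))"
    by (simp only: sum_lessThan_telescope[of "\<lambda>m. Y (real m)"])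
  then have "convergent (\<lambda>m. (Y (real m) - Y (real 0)) + Y (real 0))"
    by (intro convergent_add convergent_const)
  then have lim: "(\<lambda>m. Y (real m)) \<longlonglongrightarrow> lim (\<lambda>m. Y (real m))"
    by (simp add: convergent_LIMSEQ_iff)
  have fl: "filterlim (\<lambda>t. nat \<lfloor>t\<rfloor>) sequentially (at_top :: real filter)"
    by (rule filterlim_compose[OF filterlim_nat_sequentially filterlim_floor_sequentially])
  have "((\<lambda>t. L * q ^ nat \<lfloor>t\<rfloor>) \<longlongrightarrow> 0) (at_top :: real filter)"
  proof -
    have "(\<lambda>m. L * q ^ m) \<longlonglongrightarrow> L * 0"
      using q by (intro tendsto_mult_left LIMSEQ_realpow_zero) auto
    from filterlim_compose[OF this fl] show ?thesis by simp
  qed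
  moreover have "\<forall>\<^sub>F t in at_top. norm (Y t - Y (real (nat \<lfloor>t\<rfloor>))) \<le> L * q ^ nat \<lfloor>t\<rfloor>"
    using eventually_ge_at_top[of "0::real"]
  proof eventually_elim
    case (elim t)
    then show ?case by (intro osc) (auto simp: of_nat_nat)
  qed
  ultimately have "((\<lambda>t. Y t - Y (real (nat \<lfloor>t\<rfloor>))) \<longlongrightarrow> 0) at_top"
    by (rule Lim_null_comparison[rotated])
  moreover have "((\<lambda>t. Y (real (nat \<lfloor>t\<rfloor>))) \<longlongrightarrow> lim (\<lambda>m. Y (real m))) (at_top :: real filter)"
    by (rule filterlim_compose[OF lim fl])
  ultimately show ?thesis
    using tendsto_add[of "\<lambda>t. Y t - Y (real (nat \<lfloor>t\<rfloor>))" 0] by fastforce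
qed

theorem theorem2p2:
  fixes M :: "'w measure"
    and b \<gamma> :: real
    and Z :: "real \<Rightarrow> nat \<Rightarrow> 'w \<Rightarrow> real ^ 'n"
    and W :: "nat \<Rightarrow> nat \<Rightarrow> real \<Rightarrow> 'w \<Rightarrow> real ^ 'n"
    and p :: "nat \<Rightarrow> nat \<Rightarrow> 'w \<Rightarrow> nat"
  assumes "interacting_branching_diffusion M b \<gamma> Z W p"
    and "\<gamma> \<noteq> 0"
    and "b < 0"
  shows "\<exists>N :: 'w \<Rightarrow> real ^ 'n.
           (AE \<omega> in M. ((\<lambda>t. exp (b * t) *\<^sub>R center_of_mass Z t \<omega>) \<longlongrightarrow> N \<omega>) at_top) \<and>
           multivariate_normal M N 0
             (((1 - exp (2 * b)) / (\<bar>b\<bar> * (2 - exp (2 * b)))) *\<^sub>R mat 1)"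
proof -
  interpret interacting_branching_diffusion M b \<gamma> Z W p by fact
  define Y where "Y t \<omega> = exp (b * t) *\<^sub>R center_of_mass Z t \<omega>" for t \<omega>
  define N where "N \<omega> = lim (\<lambda>m. Y (real m) \<omega>)" for \<omega>
  let ?c = "(1 - exp (2 * b)) / (\<bar>b\<bar> * (2 - exp (2 * b)))"
  have Y_meas [measurable]: "Y (real m) \<in> borel_measurable M" for m
    unfolding Y_def[abs_def]
    by (intro borel_measurable_scaleR borel_measurable_const center_of_mass_measurable) simp
  have "AE \<omega> in M. \<forall>m. ((\<lambda>t. center_of_mass Z t \<omega>) \<longlongrightarrow> center_of_mass Z (real (Suc m)) \<omega>)
      (at_left (real (Suc m)))"
    unfolding AE_all_countable using AE_center_of_mass_left_limit by blast
  with AE_weighted_center_oscillation[OF \<open>b < 0\<close>]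
  have conv: "AE \<omega> in M. ((\<lambda>t. Y t \<omega>) \<longlongrightarrow> N \<omega>) at_top"
  proof eventually_elim
    case (elim \<omega>)
    then obtain L where osc: "\<And>m t. t \<in> {real m..<real m + 1} \<Longrightarrow>
        norm (Y t \<omega> - Y (real m) \<omega>) \<le> L * exp (b / 2) ^ m"
      unfolding Y_def by blast
    show ?case
      unfolding N_def
    proof (rule piecewise_geometric_oscillation_converges[OF osc])
      show "((\<lambda>t. Y t \<omega>) \<longlongrightarrow> Y (real (Suc m)) \<omega>) (at_left (real (Suc m)))" for m
        unfolding Y_def using elim(2) by (intro tendsto_intros) auto
    qed (use \<open>b < 0\<close> in auto)
  qed
  have "exp (2 * b) < 1" using \<open>b < 0\<close> by simp
  moreover from this have "exp (2 * b) < 2" by linarith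
  ultimately have c: "0 < ?c" using \<open>b < 0\<close> by (intro divide_pos_pos mult_pos_pos) auto
  have "gaussian M ?c N"
  proof (rule gaussian_limit)
    \<comment> \<open>The index is shifted because the variance at time \<open>0\<close> vanishes.\<close>
    show "gaussian M (center_variance b (Suc m)) (Y (real (Suc m)))" for m
      unfolding Y_def[abs_def] by (rule weighted_center_gaussian[OF \<open>b < 0\<close>])
    show "0 < center_variance b (Suc m)" for m
      using \<open>exp (2 * b) < 1\<close> \<open>b < 0\<close> unfolding center_variance_def
      by (intro mult_pos_pos divide_pos_pos sum_pos) auto
    show "(\<lambda>m. center_variance b (Suc m)) \<longlonglongrightarrow> ?c"
      by (rule LIMSEQ_Suc[OF center_variance_limit[OF \<open>b < 0\<close>]])
    show "0 < ?c" by (rule c)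
    show "N \<in> borel_measurable M" unfolding N_def[abs_def] by measurable
    show "AE \<omega> in M. (\<lambda>m. Y (real (Suc m)) \<omega>) \<longlonglongrightarrow> N \<omega>"
      using conv
    proof eventually_elim
      case (elim \<omega>)
      show ?case
        by (rule LIMSEQ_Suc[OF filterlim_compose[OF elim filterlim_real_sequentially]])
    qed
  qed
  then show ?thesis
    using conv c unfolding Y_def by (auto simp: multivariate_normal_iff_gaussian)
qed

end
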